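(* Let $X$ be a Banach space with property $( * )$, $Y\subset X$ a closed convex subset, $U\subset X$ an open set containing $Y$, and $f:U\to\mathbb{R}$ a function which is $\mathcal{C}^1$-smooth on $Y$ as a function on $U$. Then there is a $\mathcal{C}^1$-smooth function $H:X\to\mathbb{R}$ with $H|_Y=f|_Y$. Furthermore, there is a constant $C$ depending only on $X$ such that, if in addition $f$ is Lipschitz on $Y$, then $H$ can be chosen $\mathcal{C}^1$-smooth and Lipschitz on $X$ with $H|_Y=f|_Y$ and $\operatorname{Lip}(H)\le C\operatorname{Lip}(f|_Y)$.
   Context: A Banach space $X$ has property $( * )$ if there is a constant $C_0$, depending only on $X$, such that for every Lipschitz function $f:X\to\mathbb{R}$ and every $\varepsilon>0$ there is a Lipschitz, $\mathcal{C}^1$-smooth function $K:X\to\mathbb{R}$ with $|f(x)-K(x)|<\varepsilon$ for all $x\in X$ and $\operatorname{Lip}(K)\le C_0\operatorname{Lip}(f)$. A function $f:U\to\mathbb{R}$ ($U$ open, $Y\subset U$) is $\mathcal{C}^1$-smooth on $Y$ as a function on $U$ if $f$ is (Fréchet) differentiable at every point $y\in Y$ and the map $Y\to X^*$, $y\mapsto f'(y)$, is continuous on $Y$. *)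

theory Defs
  imports "HOL-Analysis.Analysis"
begin

definition C1_on :: "'a::real_normed_vector set \<Rightarrow> ('a \<Rightarrow> real) \<Rightarrow> bool" where
  "C1_on Y f \<longleftrightarrow> (\<exists>f' :: 'a \<Rightarrow> ('a \<Rightarrow>\<^sub>L real).
      (\<forall>y\<in>Y. (f has_derivative blinfun_apply (f' y)) (at y)) \<and> continuous_on Y f')"

definition is_lipschitz :: "'a::metric_space set \<Rightarrow> ('a \<Rightarrow> 'b::metric_space) \<Rightarrow> bool" where
  "is_lipschitz S f \<longleftrightarrow> (\<exists>L. lipschitz_on L S f)"

definition Lip :: "'a::metric_space set \<Rightarrow> ('a \<Rightarrow> 'b::metric_space) \<Rightarrow> real" where
  "Lip S f = Inf {L. lipschitz_on L S f}"

definition property_star :: "'a::banach itself \<Rightarrow> bool" where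
  "property_star TYPE('a) \<longleftrightarrow> (\<exists>C0::real. \<forall>f :: 'a \<Rightarrow> real. is_lipschitz UNIV f \<longrightarrow>
     (\<forall>\<epsilon>>0. \<exists>K :: 'a \<Rightarrow> real. C1_on UNIV K \<and> is_lipschitz UNIV K \<and>
        (\<forall>x. \<bar>f x - K x\<bar> < \<epsilon>) \<and> Lip UNIV K \<le> C0 * Lip UNIV f))"

end

theory Submission
  imports Defs
begin

text \<open>Suppose \<open>f\<close> is \<open>L\<close>-Lipschitz on \<open>Y\<close>. Near a point of \<open>Y\<close>, \<open>f\<close> differs from an affine function of
  slope \<open>O(L)\<close> by a function with small Lipschitz constant along \<open>Y\<close>; smoothing a Lipschitz extension of
  that difference by property \<open>(*)\<close> gives local \<open>C\<^sup>1\<close> approximations that are uniformly as close as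
  desired to a fixed Lipschitz extension \<open>F\<close> of \<open>f\<close>. They are glued by a countable \<open>C\<^sup>1\<close> partition of
  unity \<open>\<omega>\<^sub>n\<close>, the \<open>n\<close>-th error being chosen small against the Lipschitz constant of \<open>\<omega>\<^sub>n\<close>. The
  result \<open>g\<close> is \<open>O(L)\<close>-Lipschitz, while \<open>f - g\<close> is small and has small Lipschitz constant on \<open>Y\<close>.
  Repeating this with \<open>f - g\<close> in place of \<open>f\<close> and summing the resulting series yields the extension.
  For general \<open>f\<close>, the same gluing produces a \<open>C\<^sup>1\<close> function \<open>g\<close> with \<open>f - g\<close> Lipschitz on \<open>Y\<close>.\<close>

subsection \<open>Continuously differentiable functions\<close>

lemma C1_onD:
  assumes "C1_on Y f"
  obtains f' :: "'a::real_normed_vector \<Rightarrow> 'a \<Rightarrow>\<^sub>L real"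
  where "\<And>y. y \<in> Y \<Longrightarrow> (f has_derivative blinfun_apply (f' y)) (at y)" "continuous_on Y f'"
  using assms unfolding C1_on_def by blast

lemma C1_onI:
  assumes "\<And>y. y \<in> Y \<Longrightarrow> (f has_derivative blinfun_apply (f' y)) (at y)" "continuous_on Y f'"
  shows "C1_on Y f"
  using assms unfolding C1_on_def by blast

lemma C1_on_subset: "C1_on T f \<Longrightarrow> S \<subseteq> T \<Longrightarrow> C1_on S f"
  unfolding C1_on_def by (meson continuous_on_subset subsetD)

lemma C1_on_imp_continuous_on: "C1_on Y f \<Longrightarrow> continuous_on Y f"
  by (metis C1_onD continuous_at_imp_continuous_on has_derivative_continuous)

lemma C1_on_const [simp]: "C1_on Y (\<lambda>x. c)"
  by (rule C1_onI[where f' = "\<lambda>_. 0"]) (auto simp: zero_blinfun.rep_eq)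

lemma C1_on_blinfun [simp]: "C1_on Y (blinfun_apply (\<phi> :: 'a::real_normed_vector \<Rightarrow>\<^sub>L real))"
  by (rule C1_onI[where f' = "\<lambda>_. \<phi>"]) (auto intro: bounded_linear_imp_has_derivative blinfun.bounded_linear_right)

lemma C1_on_add:
  assumes "C1_on Y f" "C1_on Y g"
  shows "C1_on Y (\<lambda>x. f x + g x)"
proof -
  from assms(1) obtain f' where f: "\<And>y. y \<in> Y \<Longrightarrow> (f has_derivative blinfun_apply (f' y)) (at y)" "continuous_on Y f'"
    unfolding C1_on_def by blast
  from assms(2) obtain g' where g: "\<And>y. y \<in> Y \<Longrightarrow> (g has_derivative blinfun_apply (g' y)) (at y)" "continuous_on Y g'"
    unfolding C1_on_def by blast
  have "((\<lambda>x. f x + g x) has_derivative blinfun_apply (f' y + g' y)) (at y)" if "y \<in> Y" for y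
    unfolding plus_blinfun.rep_eq using has_derivative_add[OF f(1) g(1)] that by blast
  then show ?thesis
    by (intro C1_onI[where f' = "\<lambda>y. f' y + g' y"] continuous_intros f(2) g(2))
qed

lemma C1_on_mult:
  assumes "C1_on Y f" "C1_on Y g"
  shows "C1_on Y (\<lambda>x. f x * g x)"
proof -
  from assms(1) obtain f' where f: "\<And>y. y \<in> Y \<Longrightarrow> (f has_derivative blinfun_apply (f' y)) (at y)" "continuous_on Y f'"
    unfolding C1_on_def by blast
  from assms(2) obtain g' where g: "\<And>y. y \<in> Y \<Longrightarrow> (g has_derivative blinfun_apply (g' y)) (at y)" "continuous_on Y g'"
    unfolding C1_on_def by blast
  let ?d = "\<lambda>y. f y *\<^sub>R g' y + g y *\<^sub>R f' y"
  have "((\<lambda>x. f x * g x) has_derivative blinfun_apply (?d y)) (at y)" if "y \<in> Y" for y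
    using has_derivative_mult[OF f(1)[OF that] g(1)[OF that]]
    by (rule has_derivative_eq_rhs) (simp add: fun_eq_iff blinfun.add_left blinfun.scaleR_left)
  moreover have "continuous_on Y ?d"
    using C1_on_imp_continuous_on[OF assms(1)] C1_on_imp_continuous_on[OF assms(2)] f(2) g(2)
    by (intro continuous_on_add continuous_on_scaleR)
  ultimately show ?thesis
    unfolding C1_on_def by (intro exI[of _ ?d]) auto
qed

lemma C1_on_cmult: "C1_on Y f \<Longrightarrow> C1_on Y (\<lambda>x. c * f x)"
  by (intro C1_on_mult) auto

lemma C1_on_diff: "C1_on Y f \<Longrightarrow> C1_on Y g \<Longrightarrow> C1_on Y (\<lambda>x. f x - g x)"
  using C1_on_add[of Y f "\<lambda>x. -1 * g x"] C1_on_cmult[of Y g "-1"] by simp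

lemma C1_on_sum: "(\<And>i. i \<in> I \<Longrightarrow> C1_on Y (f i)) \<Longrightarrow> C1_on Y (\<lambda>x. \<Sum>i\<in>I. f i x)"
  by (induction I rule: infinite_finite_induct) (auto intro: C1_on_add)

lemma C1_on_prod: "(\<And>i. i \<in> I \<Longrightarrow> C1_on Y (f i)) \<Longrightarrow> C1_on Y (\<lambda>x. \<Prod>i\<in>I. f i x)"
  by (induction I rule: infinite_finite_induct) (auto intro: C1_on_mult)

lemma C1_on_compose_real:
  fixes \<theta> :: "real \<Rightarrow> real"
  assumes "C1_on Y f" "\<And>t. (\<theta> has_real_derivative \<theta>' t) (at t)" "continuous_on UNIV \<theta>'"
  shows "C1_on Y (\<lambda>x. \<theta> (f x))"
proof -
  from assms(1) obtain f' where f: "\<And>y. y \<in> Y \<Longrightarrow> (f has_derivative blinfun_apply (f' y)) (at y)" "continuous_on Y f'"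
    unfolding C1_on_def by blast
  let ?d = "\<lambda>y. \<theta>' (f y) *\<^sub>R f' y"
  have deriv: "((\<lambda>x. \<theta> (f x)) has_derivative blinfun_apply (?d y)) (at y)" if "y \<in> Y" for y
    using has_derivative_compose[OF f(1)[OF that] assms(2)[THEN has_field_derivative_imp_has_derivative]]
    by (rule has_derivative_eq_rhs) (simp add: fun_eq_iff blinfun.scaleR_left)
  have "continuous_on Y (\<lambda>y. \<theta>' (f y))"
    by (rule continuous_on_compose2[OF assms(3) C1_on_imp_continuous_on[OF assms(1)]]) auto
  then have d: "continuous_on Y ?d"
    by (intro continuous_on_scaleR f(2))
  show ?thesis
    using deriv d unfolding C1_on_def by (intro exI[of _ ?d]) auto
qed

text \<open>Uniqueness of the Frechet derivative identifies the derivatives of overlapping local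
  models, so one global derivative map is continuous near every point. This makes locally finite
  sums of C1 functions C1.\<close>

lemma C1_on_UNIV_local:
  fixes f :: "'a::real_normed_vector \<Rightarrow> real"
  assumes "\<And>x. \<exists>V g. open V \<and> x \<in> V \<and> C1_on UNIV g \<and> (\<forall>z\<in>V. f z = g z)"
  shows "C1_on UNIV f"
proof -
  define f' where "f' x = Blinfun (frechet_derivative f (at x))" for x
  have *: "(f has_derivative blinfun_apply (f' x)) (at x) \<and> isCont f' x" for x
  proof -
    obtain V g where V: "open V" "x \<in> V" "C1_on UNIV g" "\<And>z. z \<in> V \<Longrightarrow> f z = g z"
      using assms[of x] by auto
    obtain g' where g: "\<And>y. (g has_derivative blinfun_apply (g' y)) (at y)" "continuous_on UNIV g'"
      using V(3) unfolding C1_on_def by auto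
    have fg: "(f has_derivative blinfun_apply (g' z)) (at z)" if "z \<in> V" for z
      by (rule has_derivative_transform_within_open[OF g(1) V(1) that]) (simp add: V(4))
    have eq: "f' z = g' z" if "z \<in> V" for z
      unfolding f'_def frechet_derivative_at[OF fg[OF that], symmetric] by (rule blinfun_apply_inverse)
    have "isCont g' x"
      using g(2) by (simp add: continuous_on_eq_continuous_at)
    moreover have "\<forall>\<^sub>F z in nhds x. f' z = g' z"
      using V(1,2) eq by (auto simp: eventually_nhds)
    ultimately have "isCont f' x"
      using isCont_cong by metis
    then show ?thesis
      using fg[OF V(2)] eq[OF V(2)] by simp
  qed
  then have "continuous_on UNIV f'"
    by (simp add: continuous_at_imp_continuous_on)
  with * show ?thesis
    unfolding C1_on_def by (intro exI[of _ f']) auto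
qed

section \<open>A C1 cutoff on the real line\<close>

definition pos_sq :: "real \<Rightarrow> real" where "pos_sq s = (max 0 s)\<^sup>2"

text \<open>The inner square lets the function leave the value 1 smoothly at \<open>t = 1\<close>;
  the argument of the outer square reaches 0 at \<open>t = 2\<close>, where squaring removes the
  corner.\<close>

definition cutoff :: "real \<Rightarrow> real" where "cutoff t = pos_sq (1 - pos_sq (t - 1))"

lemma DERIV_pos_sq: "(pos_sq has_real_derivative 2 * max 0 t) (at t)"
proof -
  consider "t < 0" | "t = 0" | "t > 0" by linarith
  then show ?thesis
  proof cases
    case 1
    have "((\<lambda>_. 0) has_real_derivative 2 * max 0 t) (at t)" using 1 by auto
    then show ?thesis
      by (rule has_field_derivative_transform_within_open[where S = "{..<0}"]) (use 1 in \<open>auto simp: pos_sq_def\<close>)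
  next
    case 2
    have "((\<lambda>h. (pos_sq (0 + h) - pos_sq 0) / h) \<longlongrightarrow> 0) (at 0)"
    proof (rule Lim_null_comparison[where g = "\<lambda>h. \<bar>h\<bar>"])
      show "\<forall>\<^sub>F h in at 0. norm ((pos_sq (0 + h) - pos_sq 0) / h) \<le> \<bar>h\<bar>"
        by (rule always_eventually) (auto simp: pos_sq_def max_def power2_eq_square)
      show "((\<lambda>h::real. \<bar>h\<bar>) \<longlongrightarrow> 0) (at 0)" by (rule tendsto_eq_intros | simp)+
    qed
    then show ?thesis unfolding DERIV_def using 2 by simp
  next
    case 3
    have "((\<lambda>t. t\<^sup>2) has_real_derivative 2 * max 0 t) (at t)"
      using 3 by (auto intro!: derivative_eq_intros)
    then show ?thesis
      by (rule has_field_derivative_transform_within_open[where S = "{0<..}"]) (use 3 in \<open>auto simp: pos_sq_def\<close>)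
  qed
qed

lemma DERIV_cutoff:
  "(cutoff has_real_derivative - 4 * max 0 (1 - pos_sq (t - 1)) * max 0 (t - 1)) (at t)"
proof -
  have "((\<lambda>t. 1 - pos_sq (t - 1)) has_real_derivative - (2 * max 0 (t - 1))) (at t)"
    by (auto intro!: derivative_eq_intros DERIV_chain2[where f = pos_sq] DERIV_pos_sq)
  from DERIV_chain2[OF DERIV_pos_sq this] show ?thesis
    unfolding cutoff_def[abs_def] by (simp add: algebra_simps)
qed

lemma C1_on_cutoff: "C1_on Y f \<Longrightarrow> C1_on Y (\<lambda>x. cutoff (f x))"
  by (rule C1_on_compose_real[OF _ DERIV_cutoff]) (auto simp: pos_sq_def intro!: continuous_intros)

lemma cutoff_eq_1: "t \<le> 1 \<Longrightarrow> cutoff t = 1"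
  by (simp add: cutoff_def pos_sq_def)

lemma pos_sq_ge_1: "s \<ge> 1 \<Longrightarrow> pos_sq s \<ge> 1"
  by (simp add: pos_sq_def)

lemma cutoff_eq_0: "t \<ge> 2 \<Longrightarrow> cutoff t = 0"
  using pos_sq_ge_1[of "t - 1"] by (simp add: cutoff_def pos_sq_def[of "1 - _"])

lemma cutoff_bounds: "0 \<le> cutoff t" "cutoff t \<le> 1"
proof -
  have "0 \<le> pos_sq s" for s by (simp add: pos_sq_def)
  then show "0 \<le> cutoff t" "cutoff t \<le> 1"
    unfolding cutoff_def by (auto simp: pos_sq_def max_def power_le_one)
qed

lemma lipschitz_on_cutoff: "4-lipschitz_on UNIV cutoff"
proof (rule bounded_derivative_imp_lipschitz)
  let ?d = "\<lambda>t. - 4 * max 0 (1 - pos_sq (t - 1)) * max 0 (t - 1)"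
  show "(cutoff has_derivative (*) (?d t)) (at t within UNIV)" for t
    using DERIV_cutoff by (simp add: has_field_derivative_def)
  \<comment> \<open>Up to \<open>t = 2\<close> both factors are at most 1; beyond it the first one
    vanishes.\<close>
  have d: "\<bar>?d t\<bar> \<le> 4" for t
  proof (cases "t \<le> 2")
    case True
    have "max 0 (1 - pos_sq (t - 1)) \<le> 1" by (simp add: pos_sq_def)
    moreover have "max 0 (t - 1) \<le> 1" using True by simp
    ultimately have "max 0 (1 - pos_sq (t - 1)) * max 0 (t - 1) \<le> 1"
      by (meson max.cobounded1 mult_le_one)
    then show ?thesis by (simp add: abs_mult)
  next
    case False
    then show ?thesis using pos_sq_ge_1[of "t - 1"] by simp
  qed
  show "onorm ((*) (?d t)) \<le> 4" for t
  proof (rule onorm_le)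
    fix x show "norm (?d t * x) \<le> 4 * norm x"
      unfolding real_norm_def abs_mult[of "?d t"] by (rule mult_right_mono[OF d abs_ge_zero])
  qed
qed auto

text \<open>Difference quotients in direction \<open>h\<close> are bounded by
  \<open>L * norm h\<close>, and so is their limit. This lets Lipschitz constants dominate the
  derivatives in \<open>C1_on_series\<close>.\<close>

lemma has_derivative_norm_le_lipschitz:
  fixes f :: "'a::real_normed_vector \<Rightarrow> real"
  assumes "(f has_derivative blinfun_apply \<phi>) (at x)" "L-lipschitz_on UNIV f"
  shows "norm \<phi> \<le> L"
proof (rule norm_blinfun_bound)
  show "0 \<le> L" using assms(2) lipschitz_on_nonneg by blast
  fix h
  have "((\<lambda>t. f (x + t *\<^sub>R h)) has_derivative (\<lambda>t. \<phi> (t *\<^sub>R h))) (at 0)"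
    by (rule has_derivative_compose[where g = f]) (use assms(1) in \<open>auto intro!: derivative_eq_intros\<close>)
  then have "((\<lambda>t. f (x + t *\<^sub>R h)) has_real_derivative \<phi> h) (at 0)"
    by (simp add: has_field_derivative_def blinfun.scaleR_right mult_commute_abs)
  then have "((\<lambda>t. norm ((f (x + (0 + t) *\<^sub>R h) - f (x + 0 *\<^sub>R h)) / t)) \<longlongrightarrow> norm (\<phi> h)) (at 0)"
    unfolding DERIV_def by (intro tendsto_norm)
  then show "norm (\<phi> h) \<le> L * norm h"
  proof (rule tendsto_upperbound)
    have "norm ((f (x + (0 + t) *\<^sub>R h) - f (x + 0 *\<^sub>R h)) / t) \<le> L * norm h" if "t \<noteq> 0" for t
      using lipschitz_on_normD[OF assms(2), of "x + t *\<^sub>R h" x] that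
      by (simp add: pos_divide_le_eq mult_ac)
    then show "\<forall>\<^sub>F t in at 0. norm ((f (x + (0 + t) *\<^sub>R h) - f (x + 0 *\<^sub>R h)) / t) \<le> L * norm h"
      by (simp add: eventually_at_filter)
  qed simp
qed

subsection \<open>Lipschitz functions\<close>

text \<open>In the product rule each increment is multiplied by factors of size at most 1, so the
  constants add up. Existence is enough: \<open>C1_glue\<close> chooses its tolerances after the
  constants are known.\<close>

lemma lipschitz_on_prod_bounded:
  fixes f :: "nat \<Rightarrow> 'a::metric_space \<Rightarrow> real"
  assumes "\<And>i x. i < n \<Longrightarrow> \<bar>f i x\<bar> \<le> 1" "\<And>i. i < n \<Longrightarrow> \<exists>L. L-lipschitz_on S (f i)"
  shows "\<exists>L. L-lipschitz_on S (\<lambda>x. \<Prod>i<n. f i x)"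
  using assms
proof (induction n)
  case 0
  then show ?case by (auto intro: lipschitz_intros)
next
  case (Suc n)
  obtain L where L: "L-lipschitz_on S (\<lambda>x. \<Prod>i<n. f i x)" using Suc by force
  obtain M where M: "M-lipschitz_on S (f n)" using Suc.prems by blast
  have b: "\<bar>\<Prod>i<n. f i x\<bar> \<le> 1" for x
    unfolding abs_prod using Suc.prems(1) by (intro prod_le_1) auto
  have "(L + M)-lipschitz_on S (\<lambda>x. (\<Prod>i<n. f i x) * f n x)"
  proof (rule lipschitz_onI)
    fix x y assume xy: "x \<in> S" "y \<in> S"
    let ?p = "\<lambda>x. \<Prod>i<n. f i x"
    have "\<bar>?p x * f n x - ?p y * f n y\<bar> = \<bar>(?p x - ?p y) * f n x + ?p y * (f n x - f n y)\<bar>"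
      by (simp add: algebra_simps)
    also have "\<dots> \<le> \<bar>?p x - ?p y\<bar> * 1 + 1 * \<bar>f n x - f n y\<bar>"
      by (rule order_trans[OF abs_triangle_ineq])
        (auto simp: abs_mult intro!: add_mono mult_left_le mult_left_le_one_le b Suc.prems(1))
    also have "\<dots> \<le> L * dist x y + M * dist x y"
      using lipschitz_onD[OF L xy] lipschitz_onD[OF M xy] by (simp add: dist_real_def)
    finally show "dist (?p x * f n x) (?p y * f n y) \<le> (L + M) * dist x y"
      by (simp add: dist_real_def algebra_simps)
  qed (use lipschitz_on_nonneg[OF L] lipschitz_on_nonneg[OF M] in simp)
  then show ?case by auto
qed

text \<open>The segment between two points stays in \<open>S\<close>; compactness cuts it into
  pieces on which the local bound applies, and the increments add up without loss in the
  constant.\<close>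

lemma lipschitz_on_locally:
  fixes f :: "'a::real_normed_vector \<Rightarrow> real"
  assumes S: "convex S" and L: "0 \<le> L"
    and loc: "\<And>x. x \<in> S \<Longrightarrow> \<exists>V. open V \<and> x \<in> V \<and> L-lipschitz_on (S \<inter> V) f"
  shows "L-lipschitz_on S f"
proof (rule lipschitz_onI[OF _ L])
  fix x y assume xy: "x \<in> S" "y \<in> S"
  define \<gamma> where "\<gamma> t = x + t *\<^sub>R (y - x)" for t
  have \<gamma>S: "\<gamma> t \<in> S" if "0 \<le> t" "t \<le> 1" for t
    using convexD_alt[OF S xy that] by (simp add: \<gamma>_def algebra_simps)
  have d: "dist (\<gamma> a) (\<gamma> b) = \<bar>a - b\<bar> * dist x y" for a b
  proof -
    have "\<gamma> a - \<gamma> b = (a - b) *\<^sub>R (y - x)" by (simp add: \<gamma>_def algebra_simps)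
    then show ?thesis by (simp add: dist_norm norm_minus_commute)
  qed
  \<comment> \<open>The bound is proportional to \<open>b - a\<close>, hence additive over adjacent
    intervals. The guard discards small intervals that leave \<open>[0, 1]\<close>, where
    \<open>\<gamma>\<close> may leave \<open>S\<close>.\<close>
  define P where "P a b \<longleftrightarrow> (0 \<le> a \<and> a \<le> b \<and> b \<le> 1 \<longrightarrow> \<bar>f (\<gamma> a) - f (\<gamma> b)\<bar> \<le> L * (b - a) * dist x y)" for a b
  have "(0::real) \<le> 1" by simp
  then have "P 0 1"
  proof (induction rule: Bolzano)
    case (trans a b c)
    show ?case
      unfolding P_def
    proof
      assume "0 \<le> a \<and> a \<le> c \<and> c \<le> 1"
      then have "\<bar>f (\<gamma> a) - f (\<gamma> b)\<bar> \<le> L * (b - a) * dist x y"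
        "\<bar>f (\<gamma> b) - f (\<gamma> c)\<bar> \<le> L * (c - b) * dist x y"
        using trans unfolding P_def by simp_all
      moreover have "L * (c - a) * dist x y = L * (b - a) * dist x y + L * (c - b) * dist x y"
        by (simp add: algebra_simps)
      ultimately show "\<bar>f (\<gamma> a) - f (\<gamma> c)\<bar> \<le> L * (c - a) * dist x y"
        by linarith
    qed
  next
    case (local t)
    then obtain V where V: "open V" "\<gamma> t \<in> V" "L-lipschitz_on (S \<inter> V) f"
      using loc[OF \<gamma>S[OF local]] by blast
    have "isCont \<gamma> t" unfolding \<gamma>_def by (intro continuous_intros)
    then obtain U where U: "open U" "t \<in> U" "\<And>s. s \<in> U \<Longrightarrow> \<gamma> s \<in> V"
      using V(1,2) unfolding continuous_at_open by meson
    obtain e where e: "e > 0" "\<And>s. dist s t < e \<Longrightarrow> s \<in> U"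
      using U(1,2) unfolding open_dist by meson
    show ?case
    proof (intro exI[of _ e] conjI allI impI e(1))
      fix a b assume ab: "a \<le> t \<and> t \<le> b \<and> b - a < e"
      show "P a b"
        unfolding P_def
      proof
        assume "0 \<le> a \<and> a \<le> b \<and> b \<le> 1"
        then have "\<gamma> a \<in> S \<inter> V" "\<gamma> b \<in> S \<inter> V"
          using ab by (auto intro!: \<gamma>S U(3) e(2) simp: dist_real_def)
        from lipschitz_onD[OF V(3) this] show "\<bar>f (\<gamma> a) - f (\<gamma> b)\<bar> \<le> L * (b - a) * dist x y"
          using ab by (simp add: dist_real_def d mult.assoc)
      qed
    qed
  qed
  then show "dist (f x) (f y) \<le> L * dist x y"
    by (simp add: P_def \<gamma>_def dist_real_def)
qed

text \<open>The extension is the infimum of the cones \<open>f s + L * dist s x\<close> over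
  \<open>s \<in> S\<close>. The Lipschitz bound on \<open>S\<close> keeps the infimum finite and
  makes it equal to \<open>f\<close> on \<open>S\<close>.\<close>

lemma McShane_extension:
  fixes f :: "'a::metric_space \<Rightarrow> real"
  assumes "L-lipschitz_on S f"
  obtains F where "L-lipschitz_on UNIV F" "\<And>x. x \<in> S \<Longrightarrow> F x = f x"
proof (cases "S = {}")
  case True
  then show ?thesis using that[of "\<lambda>_. 0"] lipschitz_on_nonneg[OF assms]
    by (auto simp: lipschitz_on_def)
next
  case False
  define F where "F x = (INF s\<in>S. f s + L * dist s x)" for x
  have L: "L \<ge> 0" using assms lipschitz_on_nonneg by blast
  obtain s0 where s0: "s0 \<in> S" using False by blast
  have lower: "f s0 - L * dist s0 x \<le> f s + L * dist s x" if "s \<in> S" for s x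
  proof -
    have "\<bar>f s0 - f s\<bar> \<le> L * dist s0 s"
      using lipschitz_onD[OF assms s0 that] by (simp add: dist_real_def)
    also have "\<dots> \<le> L * (dist s0 x + dist s x)"
      by (intro mult_left_mono L) (metis dist_triangle dist_commute)
    finally show ?thesis by (auto simp: algebra_simps)
  qed
  then have bdd: "bdd_below ((\<lambda>s. f s + L * dist s x) ` S)" for x
    by (intro bdd_belowI2)
  have step: "F x \<le> F y + L * dist x y" for x y
  proof -
    have "F x - L * dist x y \<le> F y"
      unfolding F_def[of y]
    proof (rule cINF_greatest[OF False])
      fix s assume s: "s \<in> S"
      have "F x \<le> f s + L * dist s x"
        unfolding F_def by (rule cINF_lower[OF bdd s])
      also have "L * dist s x \<le> L * (dist s y + dist x y)"
        by (intro mult_left_mono L) (metis dist_triangle dist_commute)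
      finally show "F x - L * dist x y \<le> f s + L * dist s y" by (simp add: algebra_simps)
    qed
    then show ?thesis by simp
  qed
  have "F x = f x" if x: "x \<in> S" for x
  proof (rule antisym)
    show "F x \<le> f x"
      unfolding F_def using cINF_lower[OF bdd x, of x] by simp
    show "f x \<le> F x"
      unfolding F_def
    proof (rule cINF_greatest[OF False])
      fix s assume "s \<in> S"
      from lipschitz_onD[OF assms this x] show "f x \<le> f s + L * dist s x"
        by (simp add: dist_real_def)
    qed
  qed
  moreover have "L-lipschitz_on UNIV F"
    using step L by (intro lipschitz_onI) (auto simp: dist_real_def abs_le_iff algebra_simps, metis dist_commute)
  ultimately show ?thesis using that by blast
qed

text \<open>Each quotient \<open>dist (f x) (f y) / dist x y\<close> is a lower bound of the set of
  constants, hence at most its infimum; the assumption makes that set nonempty.\<close>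

lemma lipschitz_on_Lip:
  assumes "is_lipschitz S f"
  shows "lipschitz_on (Lip S f) S f"
proof -
  let ?A = "{L. L-lipschitz_on S f}"
  have ne: "?A \<noteq> {}" using assms by (auto simp: is_lipschitz_def)
  have "dist (f x) (f y) \<le> Lip S f * dist x y" if xy: "x \<in> S" "y \<in> S" for x y
  proof (cases "x = y")
    case False
    have "dist (f x) (f y) / dist x y \<le> Lip S f"
      unfolding Lip_def
      by (rule cInf_greatest[OF ne]) (use False xy in \<open>auto simp: divide_simps dest: lipschitz_onD\<close>)
    then show ?thesis using False by (simp add: divide_simps)
  qed simp
  moreover have "0 \<le> Lip S f"
    unfolding Lip_def by (rule cInf_greatest[OF ne]) (auto dest: lipschitz_on_nonneg)
  ultimately show ?thesis by (auto simp: lipschitz_on_def)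
qed

lemma Lip_le: "L-lipschitz_on S f \<Longrightarrow> Lip S f \<le> L"
  unfolding Lip_def by (rule cInf_lower) (auto intro!: bdd_belowI[of _ 0] dest: lipschitz_on_nonneg)

subsection \<open>The Hahn--Banach theorem\<close>

text \<open>Functionals are represented by their graphs, so that extension is inclusion of subspaces.
  Domination by \<open>L * norm\<close> makes a subspace of the product single-valued.\<close>

lemma Hahn_Banach_norm:
  fixes f :: "'a::real_normed_vector \<Rightarrow> real"
  assumes S: "subspace S" and L: "0 \<le> L"
    and add: "\<And>x y. x \<in> S \<Longrightarrow> y \<in> S \<Longrightarrow> f (x + y) = f x + f y"
    and scale: "\<And>c x. x \<in> S \<Longrightarrow> f (c *\<^sub>R x) = c * f x"
    and bound: "\<And>x. x \<in> S \<Longrightarrow> \<bar>f x\<bar> \<le> L * norm x"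
  obtains \<phi> :: "'a \<Rightarrow>\<^sub>L real" where "norm \<phi> \<le> L" "\<And>x. x \<in> S \<Longrightarrow> \<phi> x = f x"
proof -
  define G0 where "G0 = (\<lambda>x. (x, f x)) ` S"
  \<comment> \<open>A one-sided bound suffices, since a subspace contains \<open>(- x, - t)\<close>
    along with \<open>(x, t)\<close>.\<close>
  define \<A> where "\<A> = {G :: ('a \<times> real) set. subspace G \<and> G0 \<subseteq> G \<and> (\<forall>(x, t)\<in>G. t \<le> L * norm x)}"
  have "subspace G0"
    unfolding subspace_def G0_def
  proof (intro conjI ballI allI)
    have "f 0 = 0" using scale[OF subspace_0[OF S], of 0] by simp
    then show "0 \<in> (\<lambda>x. (x, f x)) ` S"
      using subspace_0[OF S] by (auto simp: zero_prod_def image_iff intro!: bexI[of _ 0])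
  next
    fix p q assume "p \<in> (\<lambda>x. (x, f x)) ` S" "q \<in> (\<lambda>x. (x, f x)) ` S"
    then obtain x y where "p = (x, f x)" "q = (y, f y)" "x \<in> S" "y \<in> S" by auto
    then show "p + q \<in> (\<lambda>x. (x, f x)) ` S"
      using subspace_add[OF S] add by (auto intro!: image_eqI[of _ _ "x + y"])
  next
    fix c p assume "p \<in> (\<lambda>x. (x, f x)) ` S"
    then obtain x where "p = (x, f x)" "x \<in> S" by auto
    then show "c *\<^sub>R p \<in> (\<lambda>x. (x, f x)) ` S"
      using subspace_scale[OF S] scale by (auto intro!: image_eqI[of _ _ "c *\<^sub>R x"])
  qed
  then have G0: "G0 \<in> \<A>"
    unfolding \<A>_def using bound by (auto simp: G0_def intro: order_trans[OF abs_ge_self])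
  have "\<Union>\<C> \<in> \<A>" if ne: "\<C> \<noteq> {}" and chain: "subset.chain \<A> \<C>" for \<C>
  proof -
    have C: "\<And>G. G \<in> \<C> \<Longrightarrow> G \<in> \<A>" "\<And>G H. G \<in> \<C> \<Longrightarrow> H \<in> \<C> \<Longrightarrow> G \<subseteq> H \<or> H \<subseteq> G"
      using chain by (auto simp: subset_chain_def)
    have sub: "\<And>G. G \<in> \<C> \<Longrightarrow> subspace G" using C(1) by (auto simp: \<A>_def)
    have "subspace (\<Union>\<C>)"
      unfolding subspace_def
    proof (intro conjI ballI allI)
      show "0 \<in> \<Union>\<C>" using ne sub subspace_0 by blast
    next
      fix p q assume "p \<in> \<Union>\<C>" "q \<in> \<Union>\<C>"
      then obtain G H where GH: "G \<in> \<C>" "H \<in> \<C>" "p \<in> G" "q \<in> H" by blast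
      then consider "p \<in> H" | "q \<in> G" using C(2) by blast
      then show "p + q \<in> \<Union>\<C>"
        by cases (use GH sub subspace_add in blast)+
    next
      fix c p assume "p \<in> \<Union>\<C>"
      then show "c *\<^sub>R p \<in> \<Union>\<C>" using sub subspace_scale by blast
    qed
    then show ?thesis
      unfolding \<A>_def using C(1) ne by (fastforce simp: \<A>_def)
  qed
  then obtain G where GA: "G \<in> \<A>" and max: "\<And>H. H \<in> \<A> \<Longrightarrow> G \<subseteq> H \<Longrightarrow> H = G"
    using subset_Zorn_nonempty[of \<A>] G0 by blast
  have G: "subspace G" and G0G: "G0 \<subseteq> G" and dom: "\<And>x t. (x, t) \<in> G \<Longrightarrow> t \<le> L * norm x"
    using GA by (auto simp: \<A>_def)
  have single: "s = t" if "(x, s) \<in> G" "(x, t) \<in> G" for x s t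
    using dom[of 0 "s - t"] dom[of 0 "t - s"] subspace_diff[OF G that] subspace_diff[OF G that(2,1)] by simp
  have total: "\<exists>t. (x0, t) \<in> G" for x0
  proof -
    let ?B = "{t - L * norm (x - x0) |x t. (x, t) \<in> G}"
    \<comment> \<open>An admissible value at \<open>x0\<close> lies above all left-hand sides and
      below all right-hand sides; this inequality makes the supremum \<open>\<xi>\<close> of the
      former such a value.\<close>
    have key: "t - L * norm (x - x0) \<le> L * norm (y + x0) - s" if "(x, t) \<in> G" "(y, s) \<in> G" for x t y s
    proof -
      have "t + s \<le> L * norm (x + y)"
        using dom subspace_add[OF G that] by simp
      also have "\<dots> \<le> L * (norm (x - x0) + norm (y + x0))"
        using norm_triangle_ineq[of "x - x0" "y + x0"] by (intro mult_left_mono L) simp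
      finally show ?thesis by (simp add: algebra_simps)
    qed
    have zG: "(0, 0) \<in> G" using subspace_0[OF G] unfolding zero_prod_def .
    define \<xi> where "\<xi> = Sup ?B"
    have bdd: "bdd_above ?B"
      using key[OF _ zG] by (intro bdd_aboveI) blast
    have lower: "t - L * norm (x - x0) \<le> \<xi>" if "(x, t) \<in> G" for x t
      unfolding \<xi>_def using that by (intro cSup_upper bdd) blast
    have upper: "\<xi> \<le> L * norm (y + x0) - s" if "(y, s) \<in> G" for y s
      unfolding \<xi>_def using zG key[OF _ that] by (intro cSup_least) blast+
    let ?H = "{p + c *\<^sub>R (x0, \<xi>) |p c. p \<in> G}"
    have "subspace ?H"
      unfolding subspace_def
    proof (intro conjI ballI allI)
      show "0 \<in> ?H" using subspace_0[OF G] by (intro CollectI exI[of _ 0]) (simp add: zero_prod_def)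
    next
      fix p q assume "p \<in> ?H" "q \<in> ?H"
      then obtain p' c q' d where "p = p' + c *\<^sub>R (x0, \<xi>)" "q = q' + d *\<^sub>R (x0, \<xi>)" "p' \<in> G" "q' \<in> G"
        by blast
      then show "p + q \<in> ?H"
        using subspace_add[OF G] by (intro CollectI exI[of _ "p' + q'"] exI[of _ "c + d"]) (simp add: algebra_simps)
    next
      fix k p assume "p \<in> ?H"
      then obtain p' c where "p = p' + c *\<^sub>R (x0, \<xi>)" "p' \<in> G" by blast
      then show "k *\<^sub>R p \<in> ?H"
        using subspace_scale[OF G]
        by (intro CollectI exI[of _ "k *\<^sub>R p'"] exI[of _ "k * c"]) (simp add: scaleR_add_right)
    qed
    moreover have GH: "G \<subseteq> ?H"
    proof
      fix p assume "p \<in> G"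
      then show "p \<in> ?H" by (intro CollectI exI[of _ p] exI[of _ "0::real"]) (simp add: zero_prod_def)
    qed
    moreover have "t \<le> L * norm x" if xt: "(x, t) \<in> ?H" for x t
    proof -
      obtain y s c where ys: "(y, s) \<in> G" and x: "x = y + c *\<^sub>R x0" and t: "t = s + c * \<xi>"
        using xt by auto
      \<comment> \<open>Division by the absolute value of \<open>c\<close> reduces the bound to
        \<open>upper\<close> for positive and to \<open>lower\<close> for negative
        \<open>c\<close>.\<close>
      consider "c = 0" | "c > 0" | "c < 0" by linarith
      then show ?thesis
      proof cases
        case 1
        then show ?thesis using dom ys x t by simp
      next
        case 2
        have "(inverse c *\<^sub>R y, inverse c * s) \<in> G"
          using subspace_scale[OF G ys, of "inverse c"] by simp
        from mult_left_mono[OF upper[OF this], of c]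
        have "c * \<xi> \<le> c * (L * norm (inverse c *\<^sub>R y + x0) - inverse c * s)"
          using 2 by simp
        also have "\<dots> = L * (c * norm (inverse c *\<^sub>R y + x0)) - s"
          using 2 by (simp add: right_diff_distrib mult.left_commute)
        also have "c * norm (inverse c *\<^sub>R y + x0) = norm (c *\<^sub>R (inverse c *\<^sub>R y + x0))"
          using 2 by simp
        also have "c *\<^sub>R (inverse c *\<^sub>R y + x0) = x"
          using 2 by (simp add: x scaleR_add_right)
        finally show ?thesis by (simp add: t)
      next
        case 3
        have "(inverse (-c) *\<^sub>R y, inverse (-c) * s) \<in> G"
          using subspace_scale[OF G ys, of "inverse (-c)"] by simp
        from mult_left_mono[OF lower[OF this], of "-c"]
        have le: "(-c) * (inverse (-c) * s - L * norm (inverse (-c) *\<^sub>R y - x0)) \<le> (-c) * \<xi>"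
          using 3 by simp
        have "s - L * ((-c) * norm (inverse (-c) *\<^sub>R y - x0)) =
            (-c) * (inverse (-c) * s - L * norm (inverse (-c) *\<^sub>R y - x0))"
          using 3 by (simp add: right_diff_distrib mult.left_commute)
        also note le
        finally have "s - L * ((-c) * norm (inverse (-c) *\<^sub>R y - x0)) \<le> - c * \<xi>" .
        also have "(-c) * norm (inverse (-c) *\<^sub>R y - x0) = norm ((-c) *\<^sub>R (inverse (-c) *\<^sub>R y - x0))"
          using 3 by simp
        also have "(-c) *\<^sub>R (inverse (-c) *\<^sub>R y - x0) = x"
          using 3 by (simp add: x scaleR_diff_right)
        finally show ?thesis by (simp add: t)
      qed
    qed
    ultimately have "?H \<in> \<A>"
      unfolding \<A>_def using G0G by blast
    with GH have "?H = G" by (intro max)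
    moreover have "(x0, \<xi>) \<in> ?H"
      using subspace_0[OF G] by (intro CollectI exI[of _ 0] exI[of _ 1]) simp
    ultimately show ?thesis by blast
  qed
  define h where "h x = (THE t. (x, t) \<in> G)" for x
  have hG: "(x, h x) \<in> G" for x
    unfolding h_def using total[of x] single by (metis theI)
  have hI: "h x = t" if "(x, t) \<in> G" for x t
    using single hG that by blast
  have hle: "norm (h x) \<le> norm x * L" for x
    using dom[OF hG[of x]] dom[of "- x" "- h x"] subspace_neg[OF G hG[of x]] by (simp add: mult.commute)
  have bl: "bounded_linear h"
  proof (rule bounded_linear_intro[OF _ _ hle])
    show "h (x + y) = h x + h y" for x y
      using hI subspace_add[OF G hG[of x] hG[of y]] by simp
    show "h (r *\<^sub>R x) = r *\<^sub>R h x" for r x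
      using hI subspace_scale[OF G hG[of x], of r] by simp
  qed
  show ?thesis
  proof (rule that[of "Blinfun h"])
    show "norm (Blinfun h) \<le> L"
      using L hle by (intro norm_blinfun_bound) (simp_all add: bounded_linear_Blinfun_apply[OF bl] mult.commute)
    show "Blinfun h x = f x" if "x \<in> S" for x
      using hI G0G that unfolding bounded_linear_Blinfun_apply[OF bl] G0_def by blast
  qed
qed

subsection \<open>Partitions of unity\<close>

text \<open>This is \<open>property_star\<close> for an arbitrary Lipschitz constant
  \<open>L\<close> instead of the least one. With \<open>C0\<close> at least 1, lower powers of
  \<open>C0\<close> are absorbed into higher ones.\<close>

locale C1_approximation =
  fixes C0 :: real
  assumes C0_ge_1: "1 \<le> C0"
    and approximation: "\<And>(f :: 'a::banach \<Rightarrow> real) L \<epsilon>. L-lipschitz_on UNIV f \<Longrightarrow> 0 < \<epsilon> \<Longrightarrow>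
      \<exists>K. C1_on UNIV K \<and> (C0 * L)-lipschitz_on UNIV K \<and> (\<forall>x. \<bar>f x - K x\<bar> < \<epsilon>)"

lemma property_star_imp_C1_approximation:
  assumes "property_star TYPE('a::banach)"
  shows "\<exists>C0. C1_approximation TYPE('a) C0"
proof -
  obtain C where C: "\<And>(f :: 'a \<Rightarrow> real) \<epsilon>. is_lipschitz UNIV f \<Longrightarrow> \<epsilon> > 0 \<Longrightarrow>
      \<exists>K. C1_on UNIV K \<and> is_lipschitz UNIV K \<and> (\<forall>x. \<bar>f x - K x\<bar> < \<epsilon>) \<and> Lip UNIV K \<le> C * Lip UNIV f"
    using assms unfolding property_star_def by blast
  have "C1_approximation TYPE('a) (max 1 C)"
  proof
    fix f :: "'a \<Rightarrow> real" and L \<epsilon> :: real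
    assume L: "L-lipschitz_on UNIV f" and "0 < \<epsilon>"
    have f: "is_lipschitz UNIV f" using L by (auto simp: is_lipschitz_def)
    obtain K where K: "C1_on UNIV K" "is_lipschitz UNIV K" "\<forall>x. \<bar>f x - K x\<bar> < \<epsilon>" "Lip UNIV K \<le> C * Lip UNIV f"
      using C[OF f \<open>0 < \<epsilon>\<close>] by blast
    have "0 \<le> Lip UNIV f" using lipschitz_on_nonneg[OF lipschitz_on_Lip[OF f]] .
    then have "C * Lip UNIV f \<le> max 1 C * L"
      using Lip_le[OF L] by (intro mult_mono) auto
    then have "(max 1 C * L)-lipschitz_on UNIV K"
      using lipschitz_on_le[OF lipschitz_on_Lip[OF K(2)]] K(4) by force
    with K show "\<exists>K. C1_on UNIV K \<and> (max 1 C * L)-lipschitz_on UNIV K \<and> (\<forall>x. \<bar>f x - K x\<bar> < \<epsilon>)"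
      by blast
  qed simp
  then show ?thesis ..
qed

context C1_approximation
begin

text \<open>A smoothing \<open>K\<close> of the distance to \<open>E\<close> with error below
  \<open>s\<close> is less than \<open>2 * s\<close> where the distance is below \<open>s\<close>,
  and more than \<open>4 * s\<close> where it is at least \<open>5 * s\<close>; scaling by
  \<open>1 / (2 * s)\<close> turns these into the thresholds 1 and 2 of
  \<open>cutoff\<close>.\<close>

lemma C1_bump:
  fixes E :: "'a set"
  assumes s: "0 < s"
  obtains \<phi> where "C1_on UNIV \<phi>" "(2 * C0 / s)-lipschitz_on UNIV \<phi>" "\<And>x. 0 \<le> \<phi> x" "\<And>x. \<phi> x \<le> 1"
    "\<And>x e. e \<in> E \<Longrightarrow> dist x e < s \<Longrightarrow> \<phi> x = 1"
    "\<And>x. (\<And>e. e \<in> E \<Longrightarrow> 5 * s \<le> dist x e) \<Longrightarrow> \<phi> x = 0"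
proof (cases "E = {}")
  case True
  \<comment> \<open>\<open>infdist\<close> to the empty set is 0 by convention, whereas the bump has
    to vanish identically here.\<close>
  have "(2 * C0 / s)-lipschitz_on UNIV (\<lambda>_::'a. 0::real)"
    using C0_ge_1 s by (intro lipschitz_on_le[OF lipschitz_on_constant]) simp
  with True show ?thesis by (intro that[of "\<lambda>_. 0"]) auto
next
  case False
  have "1-lipschitz_on UNIV (\<lambda>x. infdist x E)"
    using infdist_triangle_abs by (intro lipschitz_onI) (auto simp: dist_real_def)
  from approximation[OF this s] obtain K where K: "C1_on UNIV K" "C0-lipschitz_on UNIV K"
    "\<And>x. \<bar>infdist x E - K x\<bar> < s" by auto
  let ?\<phi> = "\<lambda>x. cutoff (1 / (2 * s) * K x)"
  show ?thesis
  proof (rule that[of ?\<phi>])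
    show "C1_on UNIV ?\<phi>" by (intro C1_on_cutoff C1_on_cmult K(1))
    have "(4 * (1 / (2 * s) * C0))-lipschitz_on UNIV ?\<phi>"
      using s by (intro lipschitz_on_compose2 lipschitz_on_subset[OF lipschitz_on_cutoff]
          lipschitz_on_cmult_real_nonneg K(2)) auto
    then show "(2 * C0 / s)-lipschitz_on UNIV ?\<phi>" by (simp add: field_simps)
    show "?\<phi> x = 1" if "e \<in> E" "dist x e < s" for x e
      using infdist_le[OF that(1), of x] that(2) K(3)[of x] s
      by (intro cutoff_eq_1) (simp add: divide_simps)
    show "?\<phi> x = 0" if "\<And>e. e \<in> E \<Longrightarrow> 5 * s \<le> dist x e" for x
    proof -
      have "5 * s \<le> infdist x E"
        unfolding infdist_notempty[OF False] by (intro cINF_greatest False that)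
      then show ?thesis
        using K(3)[of x] s by (intro cutoff_eq_0) (simp add: divide_simps)
    qed
  qed (simp_all add: cutoff_bounds)
qed

text \<open>Stone's construction. Each \<open>x\<close> is assigned the first ball of the cover containing it; this
  splits the set \<open>E n\<close> of points lying \<open>2\<^sup>-\<^sup>n\<close>-deep in their ball into pieces at mutual distance at
  least \<open>2\<^sup>-\<^sup>n\<close>. Hence a single function per \<open>n\<close> serves all pieces, and \<open>c n\<close> selects the ball.\<close>

lemma C1_partition_of_unity:
  fixes r :: "'a \<Rightarrow> real"
  assumes r: "\<And>x. 0 < r x"
  obtains \<omega> :: "nat \<Rightarrow> 'a \<Rightarrow> real" and c :: "nat \<Rightarrow> 'a \<Rightarrow> 'a"
  where "\<And>n. C1_on UNIV (\<omega> n)" "\<And>n x. 0 \<le> \<omega> n x" "\<And>n. \<exists>L. L-lipschitz_on UNIV (\<omega> n)"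
    "\<And>x. \<exists>V N. open V \<and> x \<in> V \<and> (\<forall>z\<in>V. (\<Sum>n<N. \<omega> n z) = 1) \<and> (\<forall>z\<in>V. \<forall>n\<ge>N. \<omega> n z = 0) \<and>
        (\<forall>n<N. (\<forall>z\<in>V. \<omega> n z = 0) \<or> (\<exists>b. V \<subseteq> ball b (r b) \<and> (\<forall>z\<in>V. c n z = b)))"
proof -
  \<comment> \<open>A strict well-order of the centres gives meaning to the first ball containing a
    point.\<close>
  obtain R :: "'a rel" where R: "wf R" "total R"
  proof -
    obtain R :: "'a rel" where "Well_order R" "Field R = UNIV" using well_ordering by metis
    then have "wf (R - Id)" "total (R - Id)"
      by (auto simp: well_order_on_def linear_order_on_def total_on_def)
    then show ?thesis by (rule that)
  qed
  have "\<exists>b. x \<in> ball b (r b) \<and> (\<forall>a. (a, b) \<in> R \<longrightarrow> x \<notin> ball a (r a))" for x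
  proof -
    have "x \<in> {b. x \<in> ball b (r b)}" using r by simp
    from wfE_min[OF R(1) this] show ?thesis by (metis mem_Collect_eq)
  qed
  then obtain c0 where c0: "\<And>x. x \<in> ball (c0 x) (r (c0 x))" "\<And>x a. (a, c0 x) \<in> R \<Longrightarrow> x \<notin> ball a (r a)"
    by metis
  define d :: "nat \<Rightarrow> real" where "d n = (1/2) ^ n" for n
  have d: "0 < d n" for n by (simp add: d_def)
  define E where "E n = {x. dist x (c0 x) + d n \<le> r (c0 x)}" for n
  \<comment> \<open>If \<open>c0 x\<close> comes first, then \<open>z\<close> lies outside the ball
    around \<open>c0 x\<close>, inside which \<open>x\<close> is \<open>d n\<close>-deep.\<close>
  have sep: "d n \<le> dist x z" if "x \<in> E n" "z \<in> E n" "c0 x \<noteq> c0 z" for n x z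
  proof -
    have *: "d n \<le> dist x z" if "x \<in> E n" "z \<notin> ball (c0 x) (r (c0 x))" for x z
      using that dist_triangle[of z "c0 x" x] by (simp add: E_def dist_commute)
    consider "(c0 x, c0 z) \<in> R" | "(c0 z, c0 x) \<in> R"
      using R(2) \<open>c0 x \<noteq> c0 z\<close> by (auto simp: total_on_def)
    then show ?thesis
      using *[OF \<open>x \<in> E n\<close> c0(2)[of "c0 x" z]] *[OF \<open>z \<in> E n\<close> c0(2)[of "c0 z" x]]
      by cases (simp_all add: dist_commute)
  qed
  have cover: "\<exists>n. x \<in> E n" for x
  proof -
    have "0 < r (c0 x) - dist x (c0 x)" using c0(1)[of x] by (simp add: dist_commute)
    then obtain n where "(1/2) ^ n < r (c0 x) - dist x (c0 x)"
      using real_arch_pow_inv[of "r (c0 x) - dist x (c0 x)" "1/2"] by auto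
    then show ?thesis by (intro exI[of _ n]) (simp add: E_def d_def)
  qed
  \<comment> \<open>The bump vanishes at distance \<open>5 * (d n / 32)\<close> from
    \<open>E n\<close>, which is less than the distance \<open>d n / 4\<close> up to which
    \<open>c\<close> is controlled; the gap leaves room for neighbourhoods.\<close>
  define bump where "bump n \<phi> \<longleftrightarrow> C1_on UNIV \<phi> \<and> (\<exists>L. L-lipschitz_on UNIV \<phi>) \<and>
      (\<forall>x. 0 \<le> \<phi> x \<and> \<phi> x \<le> 1) \<and>
      (\<forall>x. \<forall>e\<in>E n. dist x e < d n / 32 \<longrightarrow> \<phi> x = 1) \<and>
      (\<forall>x. (\<forall>e\<in>E n. 5 * (d n / 32) \<le> dist x e) \<longrightarrow> \<phi> x = 0)" for n \<phi>
  have "\<exists>\<phi>. bump n \<phi>" for n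
  proof -
    have "0 < d n / 32" using d by simp
    then obtain \<phi> where "C1_on UNIV \<phi>" "(2 * C0 / (d n / 32))-lipschitz_on UNIV \<phi>" "\<And>x. 0 \<le> \<phi> x" "\<And>x. \<phi> x \<le> 1"
      "\<And>x e. e \<in> E n \<Longrightarrow> dist x e < d n / 32 \<Longrightarrow> \<phi> x = 1"
      "\<And>x. (\<And>e. e \<in> E n \<Longrightarrow> 5 * (d n / 32) \<le> dist x e) \<Longrightarrow> \<phi> x = 0"
      by (rule C1_bump) blast
    then show ?thesis unfolding bump_def by (intro exI[of _ \<phi>]) blast
  qed
  then obtain \<phi> where bump: "\<And>n. bump n (\<phi> n)" by metis
  then have \<phi>: "\<And>n. C1_on UNIV (\<phi> n)" "\<And>n. \<exists>L. L-lipschitz_on UNIV (\<phi> n)"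
      "\<And>n x. 0 \<le> \<phi> n x" "\<And>n x. \<phi> n x \<le> 1"
      "\<And>n x e. e \<in> E n \<Longrightarrow> dist x e < d n / 32 \<Longrightarrow> \<phi> n x = 1"
      "\<And>n x. (\<And>e. e \<in> E n \<Longrightarrow> 5 * (d n / 32) \<le> dist x e) \<Longrightarrow> \<phi> n x = 0"
    unfolding bump_def by blast+
  \<comment> \<open>Two candidates \<open>e\<close> are less than \<open>d n / 2\<close> apart, so
    by \<open>sep\<close> they select the same centre.\<close>
  define c where "c n x = c0 (SOME e. e \<in> E n \<and> dist x e < d n / 4)" for n x
  have c: "c n x = c0 e" if "e \<in> E n" "dist x e < d n / 4" for n x e
  proof -
    let ?e = "SOME e. e \<in> E n \<and> dist x e < d n / 4"
    have "?e \<in> E n" "dist x ?e < d n / 4" using someI[of "\<lambda>e. e \<in> E n \<and> dist x e < d n / 4"] that by auto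
    then show ?thesis
      unfolding c_def using sep[of ?e n e] that d[of n] dist_triangle3[of ?e e x] by fastforce
  qed
  \<comment> \<open>The partial sums telescope, and equal 1 as soon as one of the
    \<open>\<phi> j\<close> involved equals 1.\<close>
  define \<omega> where "\<omega> n x = \<phi> n x * (\<Prod>j<n. 1 - \<phi> j x)" for n x
  have sum: "(\<Sum>n<N. \<omega> n x) = 1 - (\<Prod>j<N. 1 - \<phi> j x)" for N x
    by (induction N) (simp_all add: \<omega>_def algebra_simps)
  show ?thesis
  proof (rule that[of \<omega> c])
    fix n x
    show "C1_on UNIV (\<omega> n)"
      unfolding \<omega>_def by (intro C1_on_mult C1_on_prod C1_on_diff \<phi>(1) C1_on_const)
    show "0 \<le> \<omega> n x"
      unfolding \<omega>_def by (intro mult_nonneg_nonneg prod_nonneg) (simp_all add: \<phi>(3,4))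
    let ?f = "\<lambda>j x. if j < n then 1 - \<phi> j x else \<phi> n x"
    have "\<exists>L. L-lipschitz_on UNIV (\<lambda>x. \<Prod>j<Suc n. ?f j x)"
    proof (rule lipschitz_on_prod_bounded)
      show "\<bar>?f j x\<bar> \<le> 1" for j x using \<phi>(3,4)[of j x] \<phi>(3,4)[of n x] by auto
      show "\<exists>L. L-lipschitz_on UNIV (?f j)" for j
        using \<phi>(2)[of j] \<phi>(2)[of n] lipschitz_on_diff[OF lipschitz_on_constant[of UNIV 1]]
        by (cases "j < n") (simp, blast, simp)
    qed
    moreover have "(\<lambda>x. \<Prod>j<Suc n. ?f j x) = \<omega> n"
      by (simp add: \<omega>_def fun_eq_iff mult.commute)
    ultimately show "\<exists>L. L-lipschitz_on UNIV (\<omega> n)" by (simp only:)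
  next
    fix x
    obtain m where m: "x \<in> E m" using cover by blast
    define P where "P V n \<longleftrightarrow> (\<forall>z\<in>V. \<omega> n z = 0) \<or> (\<exists>b. V \<subseteq> ball b (r b) \<and> (\<forall>z\<in>V. c n z = b))" for V n
    have "\<exists>V. open V \<and> x \<in> V \<and> P V n" for n
    proof (cases "\<exists>e\<in>E n. dist x e < d n / 4")
      case True
      then obtain e where e: "e \<in> E n" "dist x e < d n / 4" by blast
      have "ball e (d n / 4) \<subseteq> ball (c0 e) (r (c0 e))"
      proof
        fix z assume "z \<in> ball e (d n / 4)"
        then show "z \<in> ball (c0 e) (r (c0 e))"
          using e(1) d[of n] dist_triangle[of "c0 e" z e] by (simp add: E_def dist_commute)
      qed
      moreover have "\<forall>z\<in>ball e (d n / 4). c n z = c0 e"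
        using c[OF e(1)] by (auto simp: dist_commute)
      ultimately have "P (ball e (d n / 4)) n" unfolding P_def by blast
      then show ?thesis
        using e(2) by (intro exI[of _ "ball e (d n / 4)"]) (simp add: dist_commute)
    next
      case False
      \<comment> \<open>The bump vanishes at \<open>z\<close> because
        \<open>d n / 4 - d n / 16\<close> exceeds \<open>5 * (d n / 32)\<close>.\<close>
      have "\<omega> n z = 0" if "z \<in> ball x (d n / 16)" for z
      proof -
        have "5 * (d n / 32) \<le> dist z e" if "e \<in> E n" for e
        proof -
          have "d n / 4 \<le> dist x e" using False that by (meson not_le)
          then show ?thesis
            using \<open>z \<in> ball x (d n / 16)\<close> dist_triangle[of x e z] d[of n] by (simp add: dist_commute)
        qed
        then show ?thesis by (simp add: \<omega>_def \<phi>(6))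
      qed
      then have "P (ball x (d n / 16)) n" unfolding P_def by blast
      then show ?thesis
        using d[of n] by (intro exI[of _ "ball x (d n / 16)"]) simp
    qed
    then obtain V where V: "\<And>n. open (V n)" "\<And>n. x \<in> V n" "\<And>n. P (V n) n" by metis
    \<comment> \<open>Here \<open>\<phi> m = 1\<close>, so \<open>\<omega> n\<close> has a zero
      factor for every \<open>n > m\<close>; \<open>\<omega> m\<close> itself may survive, hence
      \<open>N = Suc m\<close>.\<close>
    let ?V = "ball x (d m / 32) \<inter> (\<Inter>n<Suc m. V n)"
    have one: "\<phi> m z = 1" if "z \<in> ?V" for z
      using that by (intro \<phi>(5)[OF m]) (simp add: dist_commute)
    have zero: "(\<Prod>j<n. 1 - \<phi> j z) = 0" if "z \<in> ?V" "Suc m \<le> n" for z n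
      using one[OF that(1)] that(2) by (intro prod_zero) auto
    show "\<exists>V N. open V \<and> x \<in> V \<and> (\<forall>z\<in>V. (\<Sum>n<N. \<omega> n z) = 1) \<and> (\<forall>z\<in>V. \<forall>n\<ge>N. \<omega> n z = 0) \<and>
        (\<forall>n<N. (\<forall>z\<in>V. \<omega> n z = 0) \<or> (\<exists>b. V \<subseteq> ball b (r b) \<and> (\<forall>z\<in>V. c n z = b)))"
      unfolding P_def[symmetric]
    proof (intro exI[of _ ?V] exI[of _ "Suc m"] conjI allI impI ballI)
      show "open ?V" using V(1) by (intro open_Int open_INT) auto
      show "x \<in> ?V" using V(2) d by simp
      show "(\<Sum>n<Suc m. \<omega> n z) = 1" if "z \<in> ?V" for z
        unfolding sum using zero[OF that order_refl] by simp
      show "\<omega> n z = 0" if "z \<in> ?V" "Suc m \<le> n" for z n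
        using zero[OF that] by (simp add: \<omega>_def)
      show "P ?V n" if "n < Suc m" for n
      proof -
        have "?V \<subseteq> V n" using that by auto
        then show ?thesis using V(3)[of n] unfolding P_def by (meson subset_eq)
      qed
    qed
  qed
qed

text \<open>The increment of \<open>g - G i\<close> splits into increments of
  \<open>\<omega> n\<close> times errors \<open>h - F i\<close>, made small by the tolerances, and a
  convex combination of increments of \<open>h - G i\<close>. The radius \<open>\<rho>\<close>
  precedes \<open>\<tau>\<close> because the tolerances depend on the partition, which depends on
  the radii. The index \<open>i\<close> imposes several requirements on one
  \<open>g\<close>.\<close>

lemma C1_glue:
  fixes S :: "'i \<Rightarrow> 'a set" and F G :: "'i \<Rightarrow> 'a \<Rightarrow> real" and k :: "'i \<Rightarrow> real"
  assumes local: "\<And>x. \<exists>\<rho>>0. \<forall>\<tau>>0. \<exists>h. C1_on UNIV h \<and>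
      (\<forall>i\<in>I. (\<forall>z\<in>S i \<inter> ball x \<rho>. \<bar>h z - F i z\<bar> \<le> \<tau>) \<and> (k i)-lipschitz_on (S i \<inter> ball x \<rho>) (\<lambda>z. h z - G i z))"
    and convex: "\<And>i. i \<in> I \<Longrightarrow> convex (S i)" and \<epsilon>: "0 < \<epsilon>"
  obtains g where "C1_on UNIV g" "\<And>i z. i \<in> I \<Longrightarrow> z \<in> S i \<Longrightarrow> \<bar>g z - F i z\<bar> \<le> \<epsilon>"
    "\<And>i. i \<in> I \<Longrightarrow> (k i + \<epsilon>)-lipschitz_on (S i) (\<lambda>z. g z - G i z)"
proof -
  define Q where "Q \<tau> x \<rho> h \<longleftrightarrow> C1_on UNIV h \<and>
      (\<forall>i\<in>I. (\<forall>z\<in>S i \<inter> ball x \<rho>. \<bar>h z - F i z\<bar> \<le> \<tau>) \<and> (k i)-lipschitz_on (S i \<inter> ball x \<rho>) (\<lambda>z. h z - G i z))"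
    for \<tau> x \<rho> h
  have "\<exists>\<rho>>0. \<forall>\<tau>>0. \<exists>h. Q \<tau> x \<rho> h" for x using local unfolding Q_def .
  then obtain \<rho> where \<rho>: "\<And>x. 0 < \<rho> x" and Q: "\<And>x \<tau>. 0 < \<tau> \<Longrightarrow> \<exists>h. Q \<tau> x (\<rho> x) h" by metis
  show ?thesis
  proof (rule C1_partition_of_unity[of \<rho>, OF \<rho>])
    fix \<omega> :: "nat \<Rightarrow> 'a \<Rightarrow> real" and c :: "nat \<Rightarrow> 'a \<Rightarrow> 'a"
    assume \<omega>: "\<And>n. C1_on UNIV (\<omega> n)" "\<And>n x. 0 \<le> \<omega> n x" "\<And>n. \<exists>L. L-lipschitz_on UNIV (\<omega> n)"
      and loc: "\<And>x. \<exists>V N. open V \<and> x \<in> V \<and> (\<forall>z\<in>V. (\<Sum>n<N. \<omega> n z) = 1) \<and> (\<forall>z\<in>V. \<forall>n\<ge>N. \<omega> n z = 0) \<and>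
          (\<forall>n<N. (\<forall>z\<in>V. \<omega> n z = 0) \<or> (\<exists>b. V \<subseteq> ball b (\<rho> b) \<and> (\<forall>z\<in>V. c n z = b)))"
    obtain L where L: "\<And>n. (L n)-lipschitz_on UNIV (\<omega> n)" using \<omega>(3) by metis
    have L0: "0 \<le> L n" for n using lipschitz_on_nonneg[OF L] .
    \<comment> \<open>The products \<open>L n * \<tau> n\<close> sum to at most
      \<open>\<epsilon>\<close>; the summand 1 in the denominator also forces
      \<open>\<tau> n \<le> \<epsilon>\<close> and avoids division by 0.\<close>
    define \<tau> where "\<tau> n = \<epsilon> * (1/2) ^ Suc n / (1 + L n)" for n
    have \<tau>0: "0 < \<tau> n" for n using \<epsilon> L0[of n] by (simp add: \<tau>_def)
    have \<tau>_eq: "(1 + L n) * \<tau> n = \<epsilon> * (1/2) ^ Suc n" for n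
      using L0[of n] by (simp add: \<tau>_def del: power_Suc)
    have L\<tau>: "L n * \<tau> n \<le> \<epsilon> * (1/2) ^ Suc n" for n
      using \<tau>0[of n] \<tau>_eq[of n] by (simp add: distrib_right)
    have \<tau>\<epsilon>: "\<tau> n \<le> \<epsilon>" for n
    proof -
      have "\<tau> n \<le> (1 + L n) * \<tau> n" using \<tau>0[of n] L0[of n] by (simp add: distrib_right)
      also have "\<dots> \<le> \<epsilon> * 1" unfolding \<tau>_eq using \<epsilon> by (intro mult_left_mono power_le_one) auto
      finally show ?thesis by simp
    qed
    have "\<exists>h. Q (\<tau> n) b (\<rho> b) h" for n b using Q \<tau>0 by blast
    then obtain h where h: "\<And>n b. Q (\<tau> n) b (\<rho> b) (h n b)" by metis
    define g where "g z = (\<Sum>n. \<omega> n z * h n (c n z) z)" for z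
    have *: "\<exists>V J b. open V \<and> x \<in> V \<and> finite J \<and> (\<forall>z\<in>V. g z = (\<Sum>n\<in>J. \<omega> n z * h n (b n) z)) \<and>
        (\<forall>z\<in>V. (\<Sum>n\<in>J. \<omega> n z) = 1) \<and> (\<forall>n\<in>J. V \<subseteq> ball (b n) (\<rho> (b n)))" for x
    proof -
      obtain V N where V: "open V" "x \<in> V" and one': "\<forall>z\<in>V. (\<Sum>n<N. \<omega> n z) = 1"
        and zero: "\<forall>z\<in>V. \<forall>n\<ge>N. \<omega> n z = 0"
        and sel: "\<forall>n<N. (\<forall>z\<in>V. \<omega> n z = 0) \<or> (\<exists>b. V \<subseteq> ball b (\<rho> b) \<and> (\<forall>z\<in>V. c n z = b))"
        using loc[of x] by blast
      have one: "(\<Sum>n<N. \<omega> n z) = 1" if "z \<in> V" for z using one' that by blast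
      \<comment> \<open>An index whose \<open>\<omega> n\<close> vanishes on \<open>V\<close> need
        not come with a ball containing \<open>V\<close>, so it is dropped.\<close>
      define J where "J = {n. n < N \<and> \<not> (\<forall>z\<in>V. \<omega> n z = 0)}"
      have J: "J \<subseteq> {..<N}" "\<And>n z. n \<notin> J \<Longrightarrow> z \<in> V \<Longrightarrow> \<omega> n z = 0"
        using zero by (auto simp: J_def not_less)
      have fin: "finite J" using J(1) finite_subset by blast
      have sel': "V \<subseteq> ball (c n x) (\<rho> (c n x))" "z \<in> V \<Longrightarrow> c n z = c n x" if "n \<in> J" for n z
      proof -
        have "n < N" "\<not> (\<forall>z\<in>V. \<omega> n z = 0)" using that by (auto simp: J_def)
        with sel obtain b where "V \<subseteq> ball b (\<rho> b)" "\<forall>z\<in>V. c n z = b" by blast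
        with V(2) show "V \<subseteq> ball (c n x) (\<rho> (c n x))" "z \<in> V \<Longrightarrow> c n z = c n x" by auto
      qed
      have "g z = (\<Sum>n\<in>J. \<omega> n z * h n (c n x) z)" if z: "z \<in> V" for z
      proof -
        have "g z = (\<Sum>n\<in>J. \<omega> n z * h n (c n z) z)"
          unfolding g_def using J(2)[OF _ z] by (intro suminf_finite fin) simp
        also have "\<dots> = (\<Sum>n\<in>J. \<omega> n z * h n (c n x) z)"
          using sel'(2) z by (intro sum.cong) auto
        finally show ?thesis .
      qed
      moreover have "(\<Sum>n\<in>J. \<omega> n z) = 1" if "z \<in> V" for z
        unfolding one[OF that, symmetric] using J(1) J(2)[OF _ that] by (intro sum.mono_neutral_left) auto
      ultimately show ?thesis
        using V fin sel'(1) by (intro exI[of _ V] exI[of _ J] exI[of _ "\<lambda>n. c n x"]) auto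
    qed
    show thesis
    proof (rule that[of g])
      show "C1_on UNIV g"
      proof (rule C1_on_UNIV_local)
        fix x
        obtain V J b where V: "open V" "x \<in> V" "\<forall>z\<in>V. g z = (\<Sum>n\<in>J. \<omega> n z * h n (b n) z)"
          using *[of x] by auto
        moreover have "C1_on UNIV (\<lambda>z. \<Sum>n\<in>J. \<omega> n z * h n (b n) z)"
          using h by (intro C1_on_sum C1_on_mult \<omega>(1)) (auto simp: Q_def)
        ultimately show "\<exists>V g'. open V \<and> x \<in> V \<and> C1_on UNIV g' \<and> (\<forall>z\<in>V. g z = g' z)"
          by (intro exI[of _ V] exI[of _ "\<lambda>z. \<Sum>n\<in>J. \<omega> n z * h n (b n) z"]) simp
      qed
    next
      fix i z assume i: "i \<in> I" and z: "z \<in> S i"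
      obtain V J b where V: "z \<in> V" "g z = (\<Sum>n\<in>J. \<omega> n z * h n (b n) z)" "(\<Sum>n\<in>J. \<omega> n z) = 1"
        "\<And>n. n \<in> J \<Longrightarrow> V \<subseteq> ball (b n) (\<rho> (b n))"
        using *[of z] by metis
      have "g z - F i z = (\<Sum>n\<in>J. \<omega> n z * (h n (b n) z - F i z))"
        using V(3) by (simp add: V(2) right_diff_distrib sum_subtractf flip: sum_distrib_right)
      also have "\<bar>\<dots>\<bar> \<le> (\<Sum>n\<in>J. \<omega> n z * \<epsilon>)"
      proof (rule sum_abs[THEN order_trans], rule sum_mono)
        fix n assume "n \<in> J"
        then have "\<bar>h n (b n) z - F i z\<bar> \<le> \<tau> n"
          using h[of n "b n"] i z V(1,4) unfolding Q_def by blast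
        then show "\<bar>\<omega> n z * (h n (b n) z - F i z)\<bar> \<le> \<omega> n z * \<epsilon>"
          using \<omega>(2)[of n z] \<tau>\<epsilon>[of n] by (simp add: abs_mult mult_left_mono)
      qed
      also have "\<dots> = \<epsilon>" using V(3) by (simp flip: sum_distrib_right)
      finally show "\<bar>g z - F i z\<bar> \<le> \<epsilon>" .
    next
      fix i assume i: "i \<in> I"
      have k0: "0 \<le> k i"
        using h[of 0 undefined] i lipschitz_on_nonneg unfolding Q_def by blast
      show "(k i + \<epsilon>)-lipschitz_on (S i) (\<lambda>z. g z - G i z)"
      proof (rule lipschitz_on_locally[OF convex[OF i]])
        show "0 \<le> k i + \<epsilon>" using k0 \<epsilon> by simp
        fix x0 assume "x0 \<in> S i"
        obtain V J b where V: "open V" "x0 \<in> V" and fin: "finite J"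
          and g': "\<forall>z\<in>V. g z = (\<Sum>n\<in>J. \<omega> n z * h n (b n) z)"
          and one': "\<forall>z\<in>V. (\<Sum>n\<in>J. \<omega> n z) = 1"
          and ball: "\<forall>n\<in>J. V \<subseteq> ball (b n) (\<rho> (b n))"
          using *[of x0] by blast
        have g: "g z = (\<Sum>n\<in>J. \<omega> n z * h n (b n) z)" and one: "(\<Sum>n\<in>J. \<omega> n z) = 1" if "z \<in> V" for z
          using g' one' that by blast+
        have "(k i + \<epsilon>)-lipschitz_on (S i \<inter> V) (\<lambda>z. g z - G i z)"
        proof (rule lipschitz_onI)
          fix x z assume xz: "x \<in> S i \<inter> V" "z \<in> S i \<inter> V"
          have hF: "\<bar>h n (b n) x - F i x\<bar> \<le> \<tau> n"
            and hG: "\<bar>(h n (b n) x - G i x) - (h n (b n) z - G i z)\<bar> \<le> k i * dist x z" if n: "n \<in> J" for n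
          proof -
            have in_ball: "x \<in> S i \<inter> ball (b n) (\<rho> (b n))" "z \<in> S i \<inter> ball (b n) (\<rho> (b n))"
              using xz bspec[OF ball n] by auto
            show "\<bar>h n (b n) x - F i x\<bar> \<le> \<tau> n"
              using h[of n "b n"] i in_ball unfolding Q_def by blast
            have "(k i)-lipschitz_on (S i \<inter> ball (b n) (\<rho> (b n))) (\<lambda>z. h n (b n) z - G i z)"
              using h[of n "b n"] i unfolding Q_def by blast
            from lipschitz_onD[OF this in_ball]
            show "\<bar>(h n (b n) x - G i x) - (h n (b n) z - G i z)\<bar> \<le> k i * dist x z"
              by (simp add: dist_real_def)
          qed
          \<comment> \<open>The weights sum to 1 at both points, so subtracting the fixed number
            \<open>F i x\<close> in \<open>?A\<close> does not change the total.\<close>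
          let ?A = "\<Sum>n\<in>J. (\<omega> n x - \<omega> n z) * (h n (b n) x - F i x)"
          let ?B = "\<Sum>n\<in>J. \<omega> n z * ((h n (b n) x - G i x) - (h n (b n) z - G i z))"
          have "?A = g x - (\<Sum>n\<in>J. \<omega> n z * h n (b n) x)"
            using g one xz by (simp add: left_diff_distrib right_diff_distrib sum_subtractf flip: sum_distrib_right)
          moreover have "?B = (\<Sum>n\<in>J. \<omega> n z * h n (b n) x) - G i x - (g z - G i z)"
            using g one xz by (simp add: right_diff_distrib sum_subtractf flip: sum_distrib_right)
          ultimately have eq: "(g x - G i x) - (g z - G i z) = ?A + ?B" by simp
          have "\<bar>?A\<bar> \<le> (\<Sum>n\<in>J. \<epsilon> * (1/2) ^ Suc n * dist x z)"
          proof (rule sum_abs[THEN order_trans], rule sum_mono)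
            fix n assume n: "n \<in> J"
            have "\<bar>(\<omega> n x - \<omega> n z) * (h n (b n) x - F i x)\<bar> \<le> (L n * dist x z) * \<tau> n"
              unfolding abs_mult using lipschitz_onD[OF L[of n], of x z] hF[OF n] L0[of n]
              by (intro mult_mono) (auto simp: dist_real_def)
            also have "\<dots> = (L n * \<tau> n) * dist x z" by simp
            also have "\<dots> \<le> \<epsilon> * (1/2) ^ Suc n * dist x z" by (intro mult_right_mono L\<tau>) simp
            finally show "\<bar>(\<omega> n x - \<omega> n z) * (h n (b n) x - F i x)\<bar> \<le> \<epsilon> * (1/2) ^ Suc n * dist x z" .
          qed
          also have "\<dots> = \<epsilon> * dist x z * (\<Sum>n\<in>J. (1/2) ^ Suc n)"
            by (simp add: sum_distrib_left mult_ac)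
          also have "\<dots> \<le> \<epsilon> * dist x z * 1"
          proof (rule mult_left_mono)
            have "(\<Sum>n\<in>J. (1/2::real) ^ Suc n) \<le> (\<Sum>n. (1/2) ^ Suc n)"
              using power_half_series by (intro sum_le_suminf fin) (auto simp: sums_iff)
            then show "(\<Sum>n\<in>J. (1/2::real) ^ Suc n) \<le> 1"
              using power_half_series by (simp add: sums_iff)
          qed (use \<epsilon> in simp)
          finally have A: "\<bar>?A\<bar> \<le> \<epsilon> * dist x z" by simp
          have "\<bar>?B\<bar> \<le> (\<Sum>n\<in>J. \<omega> n z * (k i * dist x z))"
          proof (rule sum_abs[THEN order_trans], rule sum_mono)
            fix n assume "n \<in> J"
            from hG[OF this] \<omega>(2)[of n z]
            show "\<bar>\<omega> n z * ((h n (b n) x - G i x) - (h n (b n) z - G i z))\<bar> \<le> \<omega> n z * (k i * dist x z)"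
              unfolding abs_mult by (simp add: mult_left_mono)
          qed
          also have "\<dots> = k i * dist x z" using one xz by (simp flip: sum_distrib_right)
          finally have B: "\<bar>?B\<bar> \<le> k i * dist x z" .
          show "dist (g x - G i x) (g z - G i z) \<le> (k i + \<epsilon>) * dist x z"
            unfolding dist_real_def eq using A B abs_triangle_ineq[of ?A ?B] by (simp add: distrib_right)
        qed (use k0 \<epsilon> in simp)
        with V show "\<exists>V. open V \<and> x0 \<in> V \<and> (k i + \<epsilon>)-lipschitz_on (S i \<inter> V) (\<lambda>z. g z - G i z)"
          by blast
      qed
    qed
  qed
qed

end

subsection \<open>Local approximation\<close>

text \<open>The derivative of \<open>f - f' y\<close> at \<open>z\<close> is
  \<open>f' z - f' y\<close>, small near \<open>y\<close> by continuity; the mean value inequality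
  on the convex set \<open>Y \<inter> ball y \<rho>\<close> turns this into a Lipschitz
  bound.\<close>

lemma C1_on_locally_affine:
  assumes "C1_on Y f" and Y: "convex Y" "y \<in> Y" and \<eta>: "0 < \<eta>"
  obtains \<rho> and \<phi> :: "'a::real_normed_vector \<Rightarrow>\<^sub>L real"
  where "0 < \<rho>" "\<eta>-lipschitz_on (Y \<inter> ball y \<rho>) (\<lambda>z. f z - \<phi> z)"
proof -
  obtain f' where f': "\<And>y. y \<in> Y \<Longrightarrow> (f has_derivative blinfun_apply (f' y)) (at y)" "continuous_on Y f'"
    using assms(1) unfolding C1_on_def by blast
  obtain \<rho> where \<rho>: "0 < \<rho>" "\<And>z. z \<in> Y \<Longrightarrow> dist z y < \<rho> \<Longrightarrow> dist (f' z) (f' y) < \<eta>"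
    using f'(2) Y(2) \<eta> unfolding continuous_on_iff by meson
  have "\<eta>-lipschitz_on (Y \<inter> ball y \<rho>) (\<lambda>z. f z - f' y z)"
  proof (rule bounded_derivative_imp_lipschitz[where f' = "\<lambda>z. blinfun_apply (f' z - f' y)"])
    fix z assume z: "z \<in> Y \<inter> ball y \<rho>"
    have "((\<lambda>z. f z - f' y z) has_derivative (\<lambda>h. f' z h - f' y h)) (at z)"
      using z by (intro has_derivative_diff f'(1) bounded_linear_imp_has_derivative blinfun.bounded_linear_right) auto
    then show "((\<lambda>z. f z - f' y z) has_derivative blinfun_apply (f' z - f' y)) (at z within Y \<inter> ball y \<rho>)"
      by (simp add: has_derivative_at_withinI minus_blinfun.rep_eq)
    show "onorm (blinfun_apply (f' z - f' y)) \<le> \<eta>"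
    proof -
      have "dist (f' z) (f' y) < \<eta>" using \<rho>(2)[of z] z by (simp add: dist_commute)
      then show ?thesis by (simp add: dist_norm flip: norm_blinfun.rep_eq)
    qed
  qed (use Y \<eta> in \<open>auto intro: convex_Int\<close>)
  with \<rho>(1) show ?thesis by (rule that)
qed

text \<open>A functional close to a Lipschitz function on a convex set \<open>S\<close> may still have large norm, since
  \<open>S\<close> need not see all directions. The directions of \<open>S\<close> form a subspace, so Hahn--Banach applies.\<close>

lemma blinfun_norm_reduction:
  fixes \<phi> :: "'a::real_normed_vector \<Rightarrow>\<^sub>L real"
  assumes S: "convex S" and f: "L-lipschitz_on S f" and f\<phi>: "\<eta>-lipschitz_on S (\<lambda>z. f z - \<phi> z)"
  obtains \<psi> :: "'a \<Rightarrow>\<^sub>L real" where "norm \<psi> \<le> L + \<eta>" "\<eta>-lipschitz_on S (\<lambda>z. f z - \<psi> z)"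
proof (cases "S = {}")
  case True
  with that[of 0] show ?thesis
    using lipschitz_on_nonneg[OF f] lipschitz_on_nonneg[OF f\<phi>] by simp
next
  case False
  \<comment> \<open>Convexity of \<open>S\<close> puts sums back into this form, with weights
    \<open>a / (a + b)\<close> and \<open>b / (a + b)\<close>; negation exchanges \<open>u\<close>
    and \<open>v\<close>.\<close>
  let ?Z = "{c *\<^sub>R (u - v) |c u v. 0 \<le> c \<and> u \<in> S \<and> v \<in> S}"
  have L\<eta>: "0 \<le> L + \<eta>" using lipschitz_on_nonneg[OF f] lipschitz_on_nonneg[OF f\<phi>] by simp
  have Z: "subspace ?Z"
    unfolding subspace_def
  proof (intro conjI ballI allI)
    show "0 \<in> ?Z" using False by (auto intro!: exI[of _ "0::real"])
  next
    fix p q assume "p \<in> ?Z" "q \<in> ?Z"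
    then obtain a u v b u' v' where p: "p = a *\<^sub>R (u - v)" "0 \<le> a" "u \<in> S" "v \<in> S"
      and q: "q = b *\<^sub>R (u' - v')" "0 \<le> b" "u' \<in> S" "v' \<in> S" by blast
    show "p + q \<in> ?Z"
    proof (cases "a + b = 0")
      case True
      then have "a = 0" "b = 0" using p(2) q(2) by auto
      then show ?thesis using p q by (auto intro!: exI[of _ "0::real"])
    next
      case False
      let ?a = "a / (a + b)" and ?b = "b / (a + b)"
      have ab: "0 \<le> ?a" "0 \<le> ?b" "?a + ?b = 1"
        using False p(2) q(2) by (auto simp flip: add_divide_distrib)
      have "(a + b) *\<^sub>R ((?a *\<^sub>R u + ?b *\<^sub>R u') - (?a *\<^sub>R v + ?b *\<^sub>R v')) = p + q"
        using False by (simp add: p(1) q(1) scaleR_add_right scaleR_diff_right)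
      moreover have "?a *\<^sub>R u + ?b *\<^sub>R u' \<in> S" "?a *\<^sub>R v + ?b *\<^sub>R v' \<in> S"
        using convexD[OF S _ _ ab] p q by auto
      ultimately show ?thesis
        using p(2) q(2) by (metis (mono_tags, lifting) add_nonneg_nonneg mem_Collect_eq)
    qed
  next
    fix k p assume "p \<in> ?Z"
    then obtain a u v where p: "p = a *\<^sub>R (u - v)" "0 \<le> a" "u \<in> S" "v \<in> S" by blast
    show "k *\<^sub>R p \<in> ?Z"
    proof (cases "0 \<le> k")
      case True
      then show ?thesis using p by (intro CollectI exI[of _ "k * a"] exI[of _ u] exI[of _ v]) simp
    next
      case False
      then have "k *\<^sub>R p = (- k * a) *\<^sub>R (v - u)" by (simp add: p(1) algebra_simps)
      with False p show ?thesis
        by (intro CollectI exI[of _ "- k * a"] exI[of _ v] exI[of _ u]) (simp add: mult_nonpos_nonneg)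
    qed
  qed
  have bound: "\<bar>\<phi> x\<bar> \<le> (L + \<eta>) * norm x" if x: "x \<in> ?Z" for x
  proof -
    obtain c u v where x: "x = c *\<^sub>R (u - v)" "0 \<le> c" "u \<in> S" "v \<in> S" using x by blast
    have "\<bar>\<phi> (u - v)\<bar> = \<bar>(f u - f v) - ((f u - \<phi> u) - (f v - \<phi> v))\<bar>"
      by (simp add: blinfun.diff_right)
    also have "\<dots> \<le> L * norm (u - v) + \<eta> * norm (u - v)"
      using lipschitz_on_normD[OF f x(3,4)] lipschitz_on_normD[OF f\<phi> x(3,4)] by simp
    finally have "c * \<bar>\<phi> (u - v)\<bar> \<le> c * ((L + \<eta>) * norm (u - v))"
      using x(2) by (intro mult_left_mono) (simp_all add: distrib_right)
    then show ?thesis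
      using x(2) by (simp add: x(1) blinfun.scaleR_right abs_mult mult.left_commute)
  qed
  obtain \<psi> :: "'a \<Rightarrow>\<^sub>L real" where \<psi>: "norm \<psi> \<le> L + \<eta>" "\<And>x. x \<in> ?Z \<Longrightarrow> \<psi> x = \<phi> x"
    using Hahn_Banach_norm[OF Z L\<eta> blinfun.add_right _ bound] blinfun.scaleR_right[of \<phi>] by auto
  have "\<eta>-lipschitz_on S (\<lambda>z. f z - \<psi> z)"
  proof (rule lipschitz_onI)
    fix u v assume uv: "u \<in> S" "v \<in> S"
    have "u - v \<in> ?Z" using uv by (intro CollectI exI[of _ "1::real"] exI[of _ u] exI[of _ v]) simp
    from \<psi>(2)[OF this] show "dist (f u - \<psi> u) (f v - \<psi> v) \<le> \<eta> * dist u v"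
      using lipschitz_onD[OF f\<phi> uv] by (simp add: dist_real_def blinfun.diff_right algebra_simps)
  qed (rule lipschitz_on_nonneg[OF f\<phi>])
  with \<psi>(1) show ?thesis by (rule that)
qed

lemma lipschitz_on_blinfun: "(norm \<phi>)-lipschitz_on S (blinfun_apply \<phi>)"
  by (rule lipschitz_onI) (simp_all add: dist_norm norm_blinfun flip: blinfun.diff_right)

text \<open>In the product rule the increment of \<open>\<theta>\<close> is paired with the value of
  \<open>u\<close> at a point where \<open>\<theta>\<close> is nonzero; if neither point is such,
  both products vanish.\<close>

lemma lipschitz_on_localized_mult:
  fixes u \<theta> :: "'a::metric_space \<Rightarrow> real"
  assumes \<theta>: "a-lipschitz_on S \<theta>" "\<And>x. 0 \<le> \<theta> x" "\<And>x. \<theta> x \<le> 1"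
    and u: "b-lipschitz_on S u" "\<And>x. x \<in> S \<Longrightarrow> \<theta> x \<noteq> 0 \<Longrightarrow> \<bar>u x\<bar> \<le> m" and m: "0 \<le> m"
  shows "(a * m + b)-lipschitz_on S (\<lambda>x. \<theta> x * u x)"
proof (rule lipschitz_onI)
  have a: "0 \<le> a" and b: "0 \<le> b" using \<theta>(1) u(1) lipschitz_on_nonneg by auto
  then show "0 \<le> a * m + b" using m by simp
  have *: "\<bar>\<theta> x * u x - \<theta> y * u y\<bar> \<le> (a * m + b) * dist x y" if xy: "x \<in> S" "y \<in> S" and "\<theta> x \<noteq> 0" for x y
  proof -
    have "\<bar>\<theta> x * u x - \<theta> y * u y\<bar> = \<bar>(\<theta> x - \<theta> y) * u x + \<theta> y * (u x - u y)\<bar>"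
      by (simp add: algebra_simps)
    also have "\<dots> \<le> \<bar>\<theta> x - \<theta> y\<bar> * \<bar>u x\<bar> + \<theta> y * \<bar>u x - u y\<bar>"
      by (rule order_trans[OF abs_triangle_ineq]) (simp add: abs_mult \<theta>(2))
    also have "\<dots> \<le> (a * dist x y) * m + 1 * (b * dist x y)"
      using lipschitz_onD[OF \<theta>(1) xy] lipschitz_onD[OF u(1) xy] u(2)[OF xy(1) that(3)] \<theta>(2,3)[of y] a b
      by (intro add_mono mult_mono) (auto simp: dist_real_def)
    finally show ?thesis by (simp add: algebra_simps)
  qed
  fix x y assume xy: "x \<in> S" "y \<in> S"
  consider "\<theta> x \<noteq> 0" | "\<theta> y \<noteq> 0" | "\<theta> x = 0" "\<theta> y = 0" by blast
  then show "dist (\<theta> x * u x) (\<theta> y * u y) \<le> (a * m + b) * dist x y"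
  proof cases
    case 1
    then show ?thesis using *[OF xy] by (simp add: dist_real_def)
  next
    case 2
    then show ?thesis using *[OF xy(2,1)] by (simp add: dist_real_def dist_commute abs_minus_commute)
  next
    case 3
    then show ?thesis using a b m by simp
  qed
qed

context C1_approximation
begin

text \<open>Near \<open>S\<close> the function \<open>h\<close> is \<open>\<psi>\<close> plus a smoothing of a small-Lipschitz extension of \<open>F - \<psi>\<close>, which
  captures \<open>F\<close> to first order along \<open>S\<close>; away from \<open>S\<close> it is a smoothing of \<open>F\<close>. Both differ by \<open>O(s)\<close>
  at distance \<open>O(s)\<close> from \<open>S\<close>, so the bump with slope \<open>O(1/s)\<close> does not spoil the Lipschitz constant.\<close>

lemma C1_approximation_tangent:
  fixes F :: "'a \<Rightarrow> real" and \<psi> :: "'a \<Rightarrow>\<^sub>L real"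
  assumes F: "L-lipschitz_on UNIV F" and L: "0 < L" and \<psi>: "norm \<psi> \<le> 2 * L"
    and F\<psi>: "\<eta>-lipschitz_on S (\<lambda>z. F z - \<psi> z)" and \<eta>: "\<eta> \<le> L" and \<tau>: "0 < \<tau>"
  obtains h where "C1_on UNIV h" "(49 * C0\<^sup>2 * L)-lipschitz_on UNIV h" "\<And>z. \<bar>h z - F z\<bar> \<le> \<tau>"
    "(2 * C0 * \<eta>)-lipschitz_on S (\<lambda>z. h z - F z)"
proof -
  have C0: "0 < C0" using C0_ge_1 by simp
  have \<eta>0: "0 \<le> \<eta>" using lipschitz_on_nonneg[OF F\<psi>] .
  \<comment> \<open>The factor 23 is \<open>22 + 1\<close>: the bound in \<open>near\<close> plus
    the error of \<open>K\<close>, in units of \<open>C0 * (L * s)\<close>.\<close>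
  define s where "s = \<tau> / (23 * C0 * L)"
  have s: "0 < s" using \<tau> C0 L by (simp add: s_def)
  have \<tau>_eq: "\<tau> = 23 * (C0 * (L * s))" using C0 L by (simp add: s_def)
  have Ls: "0 < L * s" using L s by simp
  have LsC: "L * s \<le> C0 * (L * s)" using mult_right_mono[OF C0_ge_1, of "L * s"] Ls by simp
  obtain E where E: "\<eta>-lipschitz_on UNIV E" "\<And>z. z \<in> S \<Longrightarrow> E z = F z - \<psi> z"
    by (rule McShane_extension[OF F\<psi>]) blast
  obtain \<Delta> where \<Delta>: "C1_on UNIV \<Delta>" "(C0 * \<eta>)-lipschitz_on UNIV \<Delta>" "\<And>z. \<bar>E z - \<Delta> z\<bar> < L * s"
    using approximation[OF E(1) Ls] by blast
  obtain K where K: "C1_on UNIV K" "(C0 * L)-lipschitz_on UNIV K" "\<And>z. \<bar>F z - K z\<bar> < L * s"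
    using approximation[OF F Ls] by blast
  obtain \<theta> where \<theta>: "C1_on UNIV \<theta>" "(2 * C0 / s)-lipschitz_on UNIV \<theta>" "\<And>x. 0 \<le> \<theta> x" "\<And>x. \<theta> x \<le> 1"
    "\<And>x e. e \<in> S \<Longrightarrow> dist x e < s \<Longrightarrow> \<theta> x = 1" "\<And>x. (\<And>e. e \<in> S \<Longrightarrow> 5 * s \<le> dist x e) \<Longrightarrow> \<theta> x = 0"
    by (rule C1_bump[OF s, of S]) blast
  define A where "A z = \<psi> z + \<Delta> z" for z
  have LC: "L \<le> C0 * L" using mult_right_mono[OF C0_ge_1, of L] L by simp
  have "C0 * \<eta> \<le> C0 * L" using \<eta> C0 by simp
  then have A: "(3 * (C0 * L))-lipschitz_on UNIV A"
    unfolding A_def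
    using lipschitz_on_le[OF lipschitz_on_add[OF lipschitz_on_blinfun[of \<psi> UNIV] \<Delta>(2)], of "3 * (C0 * L)"]
    using \<psi> LC by linarith
  have AF: "\<bar>A z - F z\<bar> < L * s" if "z \<in> S" for z
    using \<Delta>(3)[of z] E(2)[OF that] by (simp add: A_def)
  \<comment> \<open>The detour through a point \<open>y\<close> of \<open>S\<close> costs at most 15
    for \<open>A\<close>, 5 for \<open>F\<close> and 1 for each of the two approximation errors, in
    units of \<open>C0 * (L * s)\<close>.\<close>
  have near: "\<bar>A x - K x\<bar> \<le> 22 * (C0 * (L * s))" if x: "\<theta> x \<noteq> 0" for x
  proof -
    obtain y where y: "y \<in> S" "dist x y < 5 * s" using \<theta>(6)[of x] x by (meson not_le)
    have "\<bar>A x - A y\<bar> \<le> 3 * (C0 * L) * (5 * s)"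
      using lipschitz_onD[OF A, of x y] y(2) C0 L
      by (auto simp: dist_real_def intro: order_trans mult_left_mono)
    moreover have "\<bar>F x - F y\<bar> \<le> L * (5 * s)"
      using lipschitz_onD[OF F, of x y] y(2) L
      by (auto simp: dist_real_def intro: order_trans mult_left_mono)
    ultimately show ?thesis
      using AF[OF y(1)] K(3)[of x] LsC by (simp add: mult.assoc)
  qed
  define h where "h z = K z + \<theta> z * (A z - K z)" for z
  show ?thesis
  proof (rule that[of h])
    show "C1_on UNIV h"
      unfolding h_def A_def by (intro C1_on_add C1_on_mult C1_on_diff C1_on_blinfun K(1) \<theta>(1) \<Delta>(1))
    \<comment> \<open>The factors \<open>s\<close> cancel, leaving 44 from the bump and
      \<open>3 + 1\<close> from \<open>A - K\<close>; with 1 from \<open>K\<close> the total is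
      49.\<close>
    have "(2 * C0 / s * (22 * (C0 * (L * s))) + (3 * (C0 * L) + C0 * L))-lipschitz_on UNIV (\<lambda>z. \<theta> z * (A z - K z))"
      by (intro lipschitz_on_localized_mult \<theta>(2-4) lipschitz_on_diff A K(2) near) (use C0 L s in auto)
    from lipschitz_on_add[OF K(2) this]
    have "(C0 * L + (2 * C0 / s * (22 * (C0 * (L * s))) + (3 * (C0 * L) + C0 * L)))-lipschitz_on UNIV h"
      unfolding h_def .
    moreover have "C0 * L \<le> C0\<^sup>2 * L"
      using mult_right_mono[OF C0_ge_1, of "C0 * L"] C0 L by (simp add: power2_eq_square mult.assoc)
    then have "C0 * L + (2 * C0 / s * (22 * (C0 * (L * s))) + (3 * (C0 * L) + C0 * L)) \<le> 49 * C0\<^sup>2 * L"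
      using s by (simp add: power2_eq_square)
    ultimately show "(49 * C0\<^sup>2 * L)-lipschitz_on UNIV h"
      by (rule lipschitz_on_le)
    show "\<bar>h z - F z\<bar> \<le> \<tau>" for z
    proof -
      have "\<bar>\<theta> z * (A z - K z)\<bar> \<le> 22 * (C0 * (L * s))"
      proof (cases "\<theta> z = 0")
        case False
        have "\<theta> z * \<bar>A z - K z\<bar> \<le> 1 * (22 * (C0 * (L * s)))"
          using near[OF False] \<theta>(3,4) by (intro mult_mono) auto
        then show ?thesis by (simp add: abs_mult \<theta>(3))
      qed (use C0 Ls in simp)
      then show ?thesis
        using K(3)[of z] LsC by (simp add: h_def \<tau>_eq)
    qed
    \<comment> \<open>On \<open>S\<close> the bump is 1, so \<open>\<psi>\<close> cancels and only
      the smoothing error of \<open>E\<close> remains.\<close>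
    have hF: "h z - F z = \<Delta> z - E z" if "z \<in> S" for z
      using \<theta>(5)[OF that, of z] s E(2)[OF that] by (simp add: h_def A_def)
    have "(C0 * \<eta> + \<eta>)-lipschitz_on S (\<lambda>z. \<Delta> z - E z)"
      using lipschitz_on_subset[OF lipschitz_on_diff[OF \<Delta>(2) E(1)]] by simp
    then have "(C0 * \<eta> + \<eta>)-lipschitz_on S (\<lambda>z. h z - F z)"
      using hF by (simp cong: lipschitz_on_cong)
    moreover have "\<eta> \<le> C0 * \<eta>" using mult_right_mono[OF C0_ge_1 \<eta>0] by simp
    ultimately show "(2 * C0 * \<eta>)-lipschitz_on S (\<lambda>z. h z - F z)"
      using lipschitz_on_le by fastforce
  qed
qed

end

subsection \<open>Extension\<close>

text \<open>The Lipschitz constants dominate the derivatives, so the series of derivatives converges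
  uniformly by the M-test; convergence at the single point \<open>x0\<close> then propagates to all
  points.\<close>

lemma C1_on_series:
  fixes g :: "nat \<Rightarrow> 'a::real_normed_vector \<Rightarrow> real"
  assumes g: "\<And>n. C1_on UNIV (g n)" "\<And>n. (a n)-lipschitz_on UNIV (g n)" and a: "summable a"
    and x0: "summable (\<lambda>n. g n x0)"
  obtains H where "C1_on UNIV H" "(suminf a)-lipschitz_on UNIV H" "\<And>x. (\<lambda>n. g n x) sums H x"
proof -
  have "\<exists>g'. (\<forall>x. (g n has_derivative blinfun_apply (g' x)) (at x)) \<and> continuous_on UNIV g'" for n
    using g(1)[of n] unfolding C1_on_def by simp
  then obtain g' where g': "\<And>n x. (g n has_derivative blinfun_apply (g' n x)) (at x)" "\<And>n. continuous_on UNIV (g' n)"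
    by metis
  have le: "norm (g' n x) \<le> a n" for n x
    by (rule has_derivative_norm_le_lipschitz[OF g'(1) g(2)])
  define G where "G x = (\<Sum>n. g' n x)" for x
  have lim: "uniform_limit UNIV (\<lambda>N x. \<Sum>n<N. g' n x) G sequentially"
    unfolding G_def using le a by (intro Weierstrass_m_test) auto
  have "\<exists>H. \<forall>x\<in>UNIV. (\<lambda>n. g n x) sums H x \<and> (H has_derivative blinfun_apply (G x)) (at x within UNIV)"
  proof (rule has_derivative_series[where f' = "\<lambda>n x. blinfun_apply (g' n x)"])
    fix e :: real assume "0 < e"
    from uniform_limitD[OF lim this]
    show "\<forall>\<^sub>F N in sequentially. \<forall>x\<in>UNIV. \<forall>h. norm ((\<Sum>n<N. g' n x h) - G x h) \<le> e * norm h"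
    proof eventually_elim
      case (elim N)
      show ?case
      proof (intro ballI allI)
        fix x h
        have "norm ((\<Sum>n<N. g' n x h) - G x h) = norm (((\<Sum>n<N. g' n x) - G x) h)"
          by (simp add: blinfun.diff_left blinfun.sum_left)
        also have "\<dots> \<le> norm ((\<Sum>n<N. g' n x) - G x) * norm h" by (rule norm_blinfun)
        also have "\<dots> \<le> e * norm h" using elim by (intro mult_right_mono) (auto simp: dist_norm less_imp_le)
        finally show "norm ((\<Sum>n<N. g' n x h) - G x h) \<le> e * norm h" .
      qed
    qed
  qed (use g'(1) summable_sums[OF x0] in auto)
  then obtain H where H: "\<And>x. (\<lambda>n. g n x) sums H x" "\<And>x. (H has_derivative blinfun_apply (G x)) (at x)"
    by auto
  have "continuous_on UNIV G"
    by (rule uniform_limit_theorem[OF _ lim]) (auto intro!: always_eventually continuous_on_sum g'(2))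
  with H(2) have "C1_on UNIV H" unfolding C1_on_def by blast
  moreover have "(suminf a)-lipschitz_on UNIV H"
  proof (rule bounded_derivative_imp_lipschitz)
    have *: "norm (G x) \<le> suminf a" for x
      unfolding G_def
      by (rule order_trans[OF summable_norm suminf_le])
        (auto intro: summable_comparison_test'[OF a] simp: le a)
    show "onorm (blinfun_apply (G x)) \<le> suminf a" for x
      using * by (simp add: norm_blinfun.rep_eq)
    show "0 \<le> suminf a" using * norm_ge_zero order_trans by blast
  qed (use H(2) in auto)
  ultimately show ?thesis using H(1) by (rule that)
qed

section \<open>Approximation and iteration on a convex set\<close>

context C1_approximation
begin

text \<open>\<open>C1_glue\<close> is applied with a Boolean index: \<open>True\<close> asks for a
  slope bound on \<open>g\<close> everywhere, by comparison with 0, and \<open>False\<close> for a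
  small slope of \<open>g - F\<close> on \<open>Y\<close>.\<close>

lemma C1_approximation_on_convex:
  fixes f :: "'a \<Rightarrow> real"
  assumes Y: "closed Y" "convex Y" and f: "C1_on Y f" "L-lipschitz_on Y f" and L: "0 < L" and \<delta>: "0 < \<delta>"
  obtains g where "C1_on UNIV g" "(50 * C0\<^sup>2 * L)-lipschitz_on UNIV g"
    "\<And>y. y \<in> Y \<Longrightarrow> \<bar>f y - g y\<bar> \<le> \<delta>" "\<delta>-lipschitz_on Y (\<lambda>y. f y - g y)"
proof -
  have C0: "0 < C0" using C0_ge_1 by simp
  obtain F where F: "L-lipschitz_on UNIV F" "\<And>y. y \<in> Y \<Longrightarrow> F y = f y"
    by (rule McShane_extension[OF f(2)]) blast
  \<comment> \<open>Half of \<open>\<delta>\<close> is spent on the local slope error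
    \<open>2 * C0 * \<eta>\<close>, the other half on the gluing error \<open>\<epsilon>\<close>,
    which also raises the factor 49 only to 50. The bound \<open>\<eta> \<le> L\<close> keeps the
    norm of \<open>\<psi>\<close> within \<open>2 * L\<close>.\<close>
  define \<eta> where "\<eta> = min L (\<delta> / (4 * C0))"
  have \<eta>: "0 < \<eta>" "\<eta> \<le> L" using L \<delta> C0 by (simp_all add: \<eta>_def)
  have "\<eta> \<le> \<delta> / (4 * C0)" by (simp add: \<eta>_def)
  then have \<eta>\<delta>: "2 * C0 * \<eta> \<le> \<delta> / 2" using C0 by (simp add: field_simps)
  define \<epsilon> where "\<epsilon> = min (\<delta> / 2) (C0\<^sup>2 * L)"
  have \<epsilon>: "0 < \<epsilon>" "\<epsilon> \<le> \<delta> / 2" "\<epsilon> \<le> C0\<^sup>2 * L" using L \<delta> C0 by (simp_all add: \<epsilon>_def)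
  define S where "S i = (if i then UNIV else Y)" for i
  define G where "G i = (if i then \<lambda>_. 0 else F)" for i
  define k where "k i = (if i then 49 * C0\<^sup>2 * L else 2 * C0 * \<eta>)" for i
  obtain g where g: "C1_on UNIV g" "\<And>i z. i \<in> UNIV \<Longrightarrow> z \<in> S i \<Longrightarrow> \<bar>g z - F z\<bar> \<le> \<epsilon>"
    "\<And>i. i \<in> UNIV \<Longrightarrow> (k i + \<epsilon>)-lipschitz_on (S i) (\<lambda>z. g z - G i z)"
  proof (rule C1_glue[of UNIV S "\<lambda>_. F" k G \<epsilon>])
    fix x
    obtain \<rho> where \<rho>: "0 < \<rho>" "\<And>\<tau>. 0 < \<tau> \<Longrightarrow> \<exists>h. C1_on UNIV h \<and> (49 * C0\<^sup>2 * L)-lipschitz_on UNIV h \<and>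
        (\<forall>z. \<bar>h z - F z\<bar> \<le> \<tau>) \<and> (2 * C0 * \<eta>)-lipschitz_on (Y \<inter> ball x \<rho>) (\<lambda>z. h z - F z)"
    proof (cases "x \<in> Y")
      case True
      obtain \<rho> \<phi> where \<rho>: "0 < \<rho>" "\<eta>-lipschitz_on (Y \<inter> ball x \<rho>) (\<lambda>z. f z - blinfun_apply \<phi> z)"
        by (rule C1_on_locally_affine[OF f(1) Y(2) True \<eta>(1)]) blast
      have "convex (Y \<inter> ball x \<rho>)" using Y(2) by (simp add: convex_Int)
      moreover have "L-lipschitz_on (Y \<inter> ball x \<rho>) f" using f(2) by (rule lipschitz_on_subset) simp
      ultimately obtain \<psi> where \<psi>: "norm \<psi> \<le> L + \<eta>" "\<eta>-lipschitz_on (Y \<inter> ball x \<rho>) (\<lambda>z. f z - blinfun_apply \<psi> z)"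
        using \<rho>(2) by (rule blinfun_norm_reduction) blast
      have \<psi>L: "norm \<psi> \<le> 2 * L" using \<psi>(1) \<eta>(2) by simp
      have F\<psi>: "\<eta>-lipschitz_on (Y \<inter> ball x \<rho>) (\<lambda>z. F z - blinfun_apply \<psi> z)"
        using \<psi>(2) by (rule lipschitz_on_transform) (simp add: F(2))
      have "\<exists>h. C1_on UNIV h \<and> (49 * C0\<^sup>2 * L)-lipschitz_on UNIV h \<and>
        (\<forall>z. \<bar>h z - F z\<bar> \<le> \<tau>) \<and> (2 * C0 * \<eta>)-lipschitz_on (Y \<inter> ball x \<rho>) (\<lambda>z. h z - F z)" if "0 < \<tau>" for \<tau>
        by (rule C1_approximation_tangent[OF F(1) L \<psi>L F\<psi> \<eta>(2) \<open>0 < \<tau>\<close>]) blast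
      with \<rho>(1) show thesis by (rule that)
    next
      case False
      \<comment> \<open>Off the closed set \<open>Y\<close> some ball misses \<open>Y\<close>; the
        condition on \<open>Y\<close> becomes vacuous there and a direct smoothing of
        \<open>F\<close> serves.\<close>
      then obtain \<rho> where \<rho>: "0 < \<rho>" "Y \<inter> ball x \<rho> = {}"
        using Y(1) by (metis Compl_iff disjoint_eq_subset_Compl inf_commute open_Compl open_contains_ball)
      have "C0 * 1 \<le> 49 * C0\<^sup>2"
        unfolding power2_eq_square using C0_ge_1 mult_left_mono[OF C0_ge_1, of C0] by linarith
      then have CL: "C0 * L \<le> 49 * C0\<^sup>2 * L" using L by simp
      have "\<exists>h. C1_on UNIV h \<and> (49 * C0\<^sup>2 * L)-lipschitz_on UNIV h \<and>
        (\<forall>z. \<bar>h z - F z\<bar> \<le> \<tau>) \<and> (2 * C0 * \<eta>)-lipschitz_on (Y \<inter> ball x \<rho>) (\<lambda>z. h z - F z)" if "0 < \<tau>" for \<tau>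
      proof -
        obtain h where "C1_on UNIV h" "(C0 * L)-lipschitz_on UNIV h" "\<And>z. \<bar>F z - h z\<bar> < \<tau>"
          using approximation[OF F(1) \<open>0 < \<tau>\<close>] by blast
        then show ?thesis
          unfolding \<rho>(2) using C0 \<eta>(1) CL
          by (intro exI[of _ h]) (auto simp: abs_minus_commute less_imp_le intro: lipschitz_on_le)
      qed
      with \<rho>(1) show thesis by (rule that)
    qed
    show "\<exists>\<rho>>0. \<forall>\<tau>>0. \<exists>h. C1_on UNIV h \<and> (\<forall>i\<in>UNIV. (\<forall>z\<in>S i \<inter> ball x \<rho>. \<bar>h z - F z\<bar> \<le> \<tau>) \<and>
        (k i)-lipschitz_on (S i \<inter> ball x \<rho>) (\<lambda>z. h z - G i z))"
    proof (intro exI[of _ \<rho>] conjI \<rho>(1) allI impI)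
      fix \<tau> :: real assume "0 < \<tau>"
      from \<rho>(2)[OF this] obtain h where h: "C1_on UNIV h" "(49 * C0\<^sup>2 * L)-lipschitz_on UNIV h"
        "\<forall>z. \<bar>h z - F z\<bar> \<le> \<tau>" "(2 * C0 * \<eta>)-lipschitz_on (Y \<inter> ball x \<rho>) (\<lambda>z. h z - F z)" by blast
      have "(k i)-lipschitz_on (S i \<inter> ball x \<rho>) (\<lambda>z. h z - G i z)" for i
        using h(4) lipschitz_on_subset[OF h(2)] by (cases i) (simp_all add: S_def G_def k_def)
      with h(1,3) show "\<exists>h. C1_on UNIV h \<and> (\<forall>i\<in>UNIV. (\<forall>z\<in>S i \<inter> ball x \<rho>. \<bar>h z - F z\<bar> \<le> \<tau>) \<and>
          (k i)-lipschitz_on (S i \<inter> ball x \<rho>) (\<lambda>z. h z - G i z))"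
        by blast
    qed
  next
    show "convex (S i)" for i using Y(2) by (simp add: S_def)
  qed (use \<epsilon>(1) in simp_all)
  show ?thesis
  proof (rule that[OF g(1)])
    show "(50 * C0\<^sup>2 * L)-lipschitz_on UNIV g"
      by (rule lipschitz_on_le[where M = "k True + \<epsilon>"])
        (use g(3)[of True] \<epsilon>(3) in \<open>simp_all add: S_def G_def k_def mult.commute\<close>)
    show "\<bar>f y - g y\<bar> \<le> \<delta>" if "y \<in> Y" for y
      using g(2)[of True y] F(2)[OF that] \<epsilon>(2) \<delta> by (simp add: S_def)
    have "\<delta>-lipschitz_on Y (\<lambda>y. g y - F y)"
      by (rule lipschitz_on_le[where M = "k False + \<epsilon>"])
        (use g(3)[of False] \<epsilon>(2) \<eta>\<delta> in \<open>simp_all add: S_def G_def k_def\<close>)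
    then have "\<delta>-lipschitz_on Y (\<lambda>y. - (g y - F y))" by (rule lipschitz_on_minus)
    then show "\<delta>-lipschitz_on Y (\<lambda>y. f y - g y)"
      by (rule lipschitz_on_transform) (simp add: F(2))
  qed
qed

text \<open>Each step subtracts an approximation from the current remainder and halves its Lipschitz
  bound on \<open>Y\<close>. The bounds of the subtracted functions form a geometric series, whose
  sum doubles 50 to 100.\<close>

lemma C1_lipschitz_extension:
  fixes f :: "'a \<Rightarrow> real"
  assumes Y: "closed Y" "convex Y" "Y \<noteq> {}" and f: "C1_on Y f" "L-lipschitz_on Y f" and L: "0 < L"
  obtains H where "C1_on UNIV H" "(100 * C0\<^sup>2 * L)-lipschitz_on UNIV H" "\<And>y. y \<in> Y \<Longrightarrow> H y = f y"
proof -
  define a where "a n = 50 * C0\<^sup>2 * (L * (1/2) ^ n)" for n :: nat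
  \<comment> \<open>The sup bound starts at \<open>n = 1\<close>, since \<open>f\<close> itself may
    be unbounded on \<open>Y\<close>.\<close>
  define P where "P n \<phi> \<longleftrightarrow> C1_on Y \<phi> \<and> (L * (1/2) ^ n)-lipschitz_on Y \<phi> \<and>
      (n = 0 \<longrightarrow> \<phi> = f) \<and> (n \<noteq> 0 \<longrightarrow> (\<forall>y\<in>Y. \<bar>\<phi> y\<bar> \<le> L * (1/2) ^ n))" for n \<phi>
  \<comment> \<open>The subtracted function is recorded as a difference of consecutive remainders,
    so that the series telescopes to \<open>f\<close> on \<open>Y\<close>.\<close>
  define Q where "Q n \<phi> \<phi>' \<longleftrightarrow> C1_on UNIV (\<lambda>x. \<phi> x - \<phi>' x) \<and> (a n)-lipschitz_on UNIV (\<lambda>x. \<phi> x - \<phi>' x)"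
    for n and \<phi> \<phi>' :: "'a \<Rightarrow> real"
  have "\<exists>\<phi>. \<forall>n. P n (\<phi> n) \<and> Q n (\<phi> n) (\<phi> (Suc n))"
  proof (rule dependent_nat_choice)
    show "\<exists>\<phi>. P 0 \<phi>" using f by (auto simp: P_def)
  next
    fix \<phi> n assume "P n \<phi>"
    then have \<phi>: "C1_on Y \<phi>" "(L * (1/2) ^ n)-lipschitz_on Y \<phi>" by (auto simp: P_def)
    have pos: "0 < L * (1/2) ^ n" "0 < L * (1/2) ^ Suc n" using L by simp_all
    obtain g where g: "C1_on UNIV g" "(50 * C0\<^sup>2 * (L * (1/2) ^ n))-lipschitz_on UNIV g"
      "\<And>y. y \<in> Y \<Longrightarrow> \<bar>\<phi> y - g y\<bar> \<le> L * (1/2) ^ Suc n" "(L * (1/2) ^ Suc n)-lipschitz_on Y (\<lambda>y. \<phi> y - g y)"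
      by (rule C1_approximation_on_convex[OF Y(1,2) \<phi> pos]) blast
    have "P (Suc n) (\<lambda>y. \<phi> y - g y)"
      unfolding P_def using g(3,4) C1_on_diff[OF \<phi>(1) C1_on_subset[OF g(1)]] by simp
    moreover have "Q n \<phi> (\<lambda>y. \<phi> y - g y)"
      unfolding Q_def a_def using g(1,2) by simp
    ultimately show "\<exists>\<phi>'. P (Suc n) \<phi>' \<and> Q n \<phi> \<phi>'" by blast
  qed
  then obtain \<phi> where P: "\<And>n. P n (\<phi> n)" and Q: "\<And>n. Q n (\<phi> n) (\<phi> (Suc n))" by blast
  have "(\<lambda>n. \<phi> n y) \<longlonglongrightarrow> 0" if "y \<in> Y" for y
  proof (rule Lim_null_comparison)
    have "norm (\<phi> n y) \<le> L * (1/2) ^ n" if "0 < n" for n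
      using P[of n] \<open>y \<in> Y\<close> that by (simp add: P_def)
    then show "\<forall>\<^sub>F n in sequentially. norm (\<phi> n y) \<le> L * (1/2) ^ n"
      by (intro eventually_mono[OF eventually_gt_at_top[of 0]])
    show "(\<lambda>n. L * (1/2) ^ n) \<longlonglongrightarrow> 0"
      by (intro tendsto_mult_right_zero LIMSEQ_power_zero) simp
  qed
  from telescope_sums'[OF this] have sums: "(\<lambda>n. \<phi> n y - \<phi> (Suc n) y) sums f y" if "y \<in> Y" for y
    using P[of 0] that by (simp add: P_def)
  \<comment> \<open>A point of \<open>Y\<close> provides the one point of convergence that
    \<open>C1_on_series\<close> asks for.\<close>
  obtain y0 where "y0 \<in> Y" using Y(3) by blast
  have a: "a sums (100 * C0\<^sup>2 * L)"
    unfolding a_def using sums_mult[OF geometric_sums[of "1/2::real"], of "50 * C0\<^sup>2 * L"] by (simp add: mult_ac)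
  obtain H where H: "C1_on UNIV H" "(suminf a)-lipschitz_on UNIV H" "\<And>x. (\<lambda>n. \<phi> n x - \<phi> (Suc n) x) sums H x"
  proof (rule C1_on_series[of "\<lambda>n x. \<phi> n x - \<phi> (Suc n) x" a y0])
    show "summable a" using a by (rule sums_summable)
    show "summable (\<lambda>n. \<phi> n y0 - \<phi> (Suc n) y0)" using sums[OF \<open>y0 \<in> Y\<close>] by (rule sums_summable)
  qed (use Q in \<open>auto simp: Q_def\<close>)
  show ?thesis
  proof (rule that[OF H(1)])
    show "(100 * C0\<^sup>2 * L)-lipschitz_on UNIV H" using H(2) sums_unique[OF a] by simp
    show "H y = f y" if "y \<in> Y" for y using H(3) sums[OF that] by (rule sums_unique2)
  qed
qed

text \<open>Near a point of \<open>Y\<close>, \<open>f\<close> is a functional plus a 1-Lipschitz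
  remainder along \<open>Y\<close>. Smoothing the remainder leaves an error of slope
  \<open>C0 + 1\<close>, and gluing adds 1. No slope bound on \<open>g\<close> is claimed, so the
  functional may have any norm.\<close>

lemma C1_lipschitz_remainder:
  fixes f :: "'a \<Rightarrow> real"
  assumes Y: "closed Y" "convex Y" and f: "C1_on Y f"
  obtains g where "C1_on UNIV g" "(C0 + 2)-lipschitz_on Y (\<lambda>y. f y - g y)"
proof -
  have C0: "0 < C0" using C0_ge_1 by simp
  obtain g where g: "C1_on UNIV g" "\<And>i z. i \<in> (UNIV :: unit set) \<Longrightarrow> z \<in> Y \<Longrightarrow> \<bar>g z - f z\<bar> \<le> 1"
    "\<And>i. i \<in> (UNIV :: unit set) \<Longrightarrow> (C0 + 1 + 1)-lipschitz_on Y (\<lambda>z. g z - f z)"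
  proof (rule C1_glue[of "UNIV :: unit set" "\<lambda>_. Y" "\<lambda>_. f" "\<lambda>_. C0 + 1" "\<lambda>_. f" 1])
    fix x
    have "\<exists>\<rho>>0. \<forall>\<tau>>0. \<exists>h. C1_on UNIV h \<and> (\<forall>z\<in>Y \<inter> ball x \<rho>. \<bar>h z - f z\<bar> \<le> \<tau>) \<and>
        (C0 + 1)-lipschitz_on (Y \<inter> ball x \<rho>) (\<lambda>z. h z - f z)"
    proof (cases "x \<in> Y")
      case True
      obtain \<rho> \<phi> where \<rho>: "0 < \<rho>" "1-lipschitz_on (Y \<inter> ball x \<rho>) (\<lambda>z. f z - blinfun_apply \<phi> z)"
        by (rule C1_on_locally_affine[OF f Y(2) True zero_less_one]) blast
      obtain E where E: "1-lipschitz_on UNIV E" "\<And>z. z \<in> Y \<inter> ball x \<rho> \<Longrightarrow> E z = f z - blinfun_apply \<phi> z"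
        by (rule McShane_extension[OF \<rho>(2)]) blast
      show ?thesis
      proof (intro exI[of _ \<rho>] conjI \<rho>(1) allI impI)
        fix \<tau> :: real assume "0 < \<tau>"
        from approximation[OF E(1) this] obtain \<Delta> where \<Delta>: "C1_on UNIV \<Delta>" "(C0 * 1)-lipschitz_on UNIV \<Delta>"
          "\<And>z. \<bar>E z - \<Delta> z\<bar> < \<tau>" by blast
        have eq: "\<phi> z + \<Delta> z - f z = \<Delta> z - E z" if "z \<in> Y \<inter> ball x \<rho>" for z
          using E(2)[OF that] by simp
        have "(C0 * 1 + 1)-lipschitz_on (Y \<inter> ball x \<rho>) (\<lambda>z. \<Delta> z - E z)"
          using lipschitz_on_subset[OF lipschitz_on_diff[OF \<Delta>(2) E(1)]] by simp
        then have "(C0 + 1)-lipschitz_on (Y \<inter> ball x \<rho>) (\<lambda>z. \<phi> z + \<Delta> z - f z)"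
          using eq unfolding mult_1_right by (rule lipschitz_on_transform)
        moreover have "\<bar>\<phi> z + \<Delta> z - f z\<bar> \<le> \<tau>" if "z \<in> Y \<inter> ball x \<rho>" for z
          unfolding eq[OF that] using \<Delta>(3)[of z] by (simp add: abs_minus_commute less_imp_le)
        ultimately show "\<exists>h. C1_on UNIV h \<and> (\<forall>z\<in>Y \<inter> ball x \<rho>. \<bar>h z - f z\<bar> \<le> \<tau>) \<and>
            (C0 + 1)-lipschitz_on (Y \<inter> ball x \<rho>) (\<lambda>z. h z - f z)"
          by (intro exI[of _ "\<lambda>z. \<phi> z + \<Delta> z"] conjI C1_on_add C1_on_blinfun \<Delta>(1)) auto
      qed
    next
      case False
      then obtain \<rho> where \<rho>: "0 < \<rho>" "Y \<inter> ball x \<rho> = {}"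
        using Y(1) by (metis Compl_iff disjoint_eq_subset_Compl inf_commute open_Compl open_contains_ball)
      then show ?thesis
        using C0 by (intro exI[of _ \<rho>]) (auto intro!: exI[of _ "\<lambda>_. 0"])
    qed
    then show "\<exists>\<rho>>0. \<forall>\<tau>>0. \<exists>h. C1_on UNIV h \<and> (\<forall>i\<in>(UNIV :: unit set). (\<forall>z\<in>Y \<inter> ball x \<rho>. \<bar>h z - f z\<bar> \<le> \<tau>) \<and>
        (C0 + 1)-lipschitz_on (Y \<inter> ball x \<rho>) (\<lambda>z. h z - f z))"
      by simp
  qed (use Y(2) in simp_all)
  from g(3)[of "()"] have "(C0 + 2)-lipschitz_on Y (\<lambda>y. - (g y - f y))"
    unfolding lipschitz_on_minus_iff by (simp add: add.assoc)
  then have "(C0 + 2)-lipschitz_on Y (\<lambda>y. f y - g y)" by simp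
  with g(1) show ?thesis by (rule that)
qed

end

theorem theorem1p4:
  assumes "property_star TYPE('a::banach)"
  shows "(\<forall>(Y::'a set) U (f::'a \<Rightarrow> real).
            closed Y \<and> convex Y \<and> open U \<and> Y \<subseteq> U \<and> C1_on Y f \<longrightarrow>
            (\<exists>H::'a \<Rightarrow> real. C1_on UNIV H \<and> (\<forall>y\<in>Y. H y = f y)))
       \<and> (\<exists>C::real. \<forall>(Y::'a set) U (f::'a \<Rightarrow> real).
            closed Y \<and> convex Y \<and> open U \<and> Y \<subseteq> U \<and> C1_on Y f \<and> is_lipschitz Y f \<longrightarrow>
            (\<exists>H::'a \<Rightarrow> real. C1_on UNIV H \<and> is_lipschitz UNIV H \<and> (\<forall>y\<in>Y. H y = f y)
                \<and> Lip UNIV H \<le> C * Lip Y f))"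
proof -
  obtain C0 where "C1_approximation TYPE('a) C0"
    using property_star_imp_C1_approximation[OF assms] by blast
  then interpret C1_approximation C0 .
  show ?thesis
  proof (intro conjI exI[of _ "100 * C0\<^sup>2"] allI impI; elim conjE)
    fix Y U :: "'a set" and f :: "'a \<Rightarrow> real"
    assume Y: "closed Y" "convex Y" and f: "C1_on Y f"
    show "\<exists>H. C1_on UNIV H \<and> (\<forall>y\<in>Y. H y = f y)"
    proof (cases "Y = {}")
      case True
      then show ?thesis by (auto intro!: exI[of _ "\<lambda>_. 0"])
    next
      case False
      obtain g where g: "C1_on UNIV g" "(C0 + 2)-lipschitz_on Y (\<lambda>y. f y - g y)"
        by (rule C1_lipschitz_remainder[OF Y f]) blast
      have "C1_on Y (\<lambda>y. f y - g y)" by (intro C1_on_diff f C1_on_subset[OF g(1)]) simp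
      moreover have "0 < C0 + 2" using C0_ge_1 by simp
      ultimately obtain H where H: "C1_on UNIV H" "\<And>y. y \<in> Y \<Longrightarrow> H y = f y - g y"
        using C1_lipschitz_extension[OF Y False _ g(2)] by blast
      then show ?thesis
        by (intro exI[of _ "\<lambda>x. H x + g x"]) (simp add: C1_on_add g(1))
    qed
  next
    fix Y U :: "'a set" and f :: "'a \<Rightarrow> real"
    assume Y: "closed Y" "convex Y" and f: "C1_on Y f" "is_lipschitz Y f"
    have L: "(Lip Y f)-lipschitz_on Y f" using f(2) by (rule lipschitz_on_Lip)
    show "\<exists>H. C1_on UNIV H \<and> is_lipschitz UNIV H \<and> (\<forall>y\<in>Y. H y = f y) \<and> Lip UNIV H \<le> 100 * C0\<^sup>2 * Lip Y f"
    proof (cases "Lip Y f = 0")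
      case True
      \<comment> \<open>With constant 0, which \<open>C1_lipschitz_extension\<close> excludes,
        \<open>f\<close> is constant on \<open>Y\<close>. The empty set also falls here, its
        \<open>Lip\<close> being 0; the value chosen by \<open>SOME\<close> is then
        arbitrary.\<close>
      have const: "f y = f (SOME y. y \<in> Y)" if "y \<in> Y" for y
        using lipschitz_onD[OF L that someI[of "\<lambda>y. y \<in> Y", OF that]] True by simp
      have "0-lipschitz_on UNIV (\<lambda>_::'a. f (SOME y. y \<in> Y))" by (rule lipschitz_on_constant)
      with const show ?thesis
        by (intro exI[of _ "\<lambda>_. f (SOME y. y \<in> Y)"]) (auto simp: is_lipschitz_def True dest: Lip_le)
    next
      case False
      have pos: "0 < Lip Y f" using False lipschitz_on_nonneg[OF L] by simp
      have "Y \<noteq> {}"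
      proof
        assume "Y = {}"
        then have "0-lipschitz_on Y f" by simp
        from Lip_le[OF this] pos show False by simp
      qed
      then obtain H where "C1_on UNIV H" "(100 * C0\<^sup>2 * Lip Y f)-lipschitz_on UNIV H" "\<And>y. y \<in> Y \<Longrightarrow> H y = f y"
        using C1_lipschitz_extension[OF Y _ f(1) L pos] by blast
      then show ?thesis
        by (intro exI[of _ H]) (auto simp: is_lipschitz_def dest: Lip_le)
    qed
  qed
qed

end
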